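(* Let $E$ be a (real) Banach lattice, let $m$ be a positive integer, and let $P,Q\colon E\to\mathbb{R}$ be orthogonally additive $m$-homogeneous polynomials. If $P$ is order continuous, then $P\perp Q$ if and only if $C(P)\perp C(Q)$.
   Context: An $m$-homogeneous polynomial $P\colon E\to\mathbb{R}$ is a map of the form $P(x)=A(x,\dots,x)$, where $A\colon E^m\to\mathbb{R}$ is a (unique) symmetric $m$-linear map. $P$ is positive if $A(x_1,\dots,x_m)\ge 0$ for all $x_1,\dots,x_m\in E_+$, and regular if it is a difference of two positive $m$-homogeneous polynomials. The regular $m$-homogeneous polynomials on $E$ form a vector lattice under the order $P\le Q$ iff $Q-P$ is positive; $|P|$ denotes the modulus and $P\perp Q$ means $|P|\wedge|Q|=0$ in this lattice. A regular $m$-homogeneous polynomial $P$ is orthogonally additive if $P(x+y)=P(x)+P(y)$ whenever $x,y\in E$ are disjoint, i.e. $|x|\wedge|y|=0$ (so orthogonally additive polynomials are regular by definition). A net $(x_\alpha)$ in $E$ converges in order to $x$ if there are a net $(y_\alpha)$ in $E$ decreasing to $0$ (i.e. decreasing with infimum $0$) with the same index set and an index $\alpha_0$ such that $|x_\alpha-x|\le y_\alpha$ for all $\alpha\ge\alpha_0$. $P$ is order continuous at $x$ if $P(x_\alpha)\to P(x)$ whenever $(x_\alpha)$ converges in order to $x$; $P$ is order continuous if it is order continuous at every point of $E$. The null ideal of $P$ is $N(P)=\{x\in E:|P|(|x|)=0\}$ and the carrier of $P$ is $C(P)=N(P)^{\perp}=\{x\in E: |x|\wedge|y|=0 \text{ for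 all } y\in N(P)\}$. For subsets $C,D$ of $E$, $C\perp D$ means $|x|\wedge|y|=0$ for all $x\in C$, $y\in D$. *)

theory Defs
  imports "HOL-Analysis.Analysis" "HOL-Library.Lattice_Algebras" "HOL-Library.Multiset"
begin

class banach_lattice = banach + ordered_real_vector + lattice_ab_group_add_abs +
  assumes norm_mono: "\<bar>x\<bar> \<le> \<bar>y\<bar> \<Longrightarrow> norm x \<le> norm y"

definition disjoint_elts :: "'a::banach_lattice \<Rightarrow> 'a \<Rightarrow> bool" where
  "disjoint_elts x y \<longleftrightarrow> inf \<bar>x\<bar> \<bar>y\<bar> = 0"

definition disjoint_subsets :: "'a::banach_lattice set \<Rightarrow> 'a set \<Rightarrow> bool" where
  "disjoint_subsets C D \<longleftrightarrow> (\<forall>x\<in>C. \<forall>y\<in>D. disjoint_elts x y)"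

definition disjoint_complement :: "'a::banach_lattice set \<Rightarrow> 'a set" where
  "disjoint_complement D = {x. \<forall>y\<in>D. disjoint_elts x y}"


section \<open>Homogeneous polynomials\<close>

text \<open>The elements of \<open>E\<^sup>m\<close> are the lists of length \<open>m\<close>; the values of a form
  on lists of any other length are irrelevant.\<close>

definition symmetric_multilinear :: "nat \<Rightarrow> ('a::real_vector list \<Rightarrow> real) \<Rightarrow> bool" where
  "symmetric_multilinear m A \<longleftrightarrow>
     (\<forall>xs i. length xs = m \<and> i < m \<longrightarrow> linear (\<lambda>x. A (xs[i := x]))) \<and>
     (\<forall>xs ys. length xs = m \<and> mset ys = mset xs \<longrightarrow> A ys = A xs)"

text \<open>An \<open>m\<close>-homogeneous polynomial is a \<open>P\<close> of the form \<open>P x = A (replicate m x)\<close> with \<open>A\<close>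
  symmetric and \<open>m\<close>-linear. By polarization \<open>P\<close> determines \<open>A\<close> on lists of length \<open>m\<close>, so the
  existential quantifier below ranges over a single form on \<open>E\<^sup>m\<close>.\<close>

definition positive_poly :: "nat \<Rightarrow> ('a::banach_lattice \<Rightarrow> real) \<Rightarrow> bool" where
  "positive_poly m P \<longleftrightarrow>
     (\<exists>A. symmetric_multilinear m A \<and> (\<forall>x. P x = A (replicate m x)) \<and>
          (\<forall>xs. length xs = m \<and> (\<forall>x\<in>set xs. 0 \<le> x) \<longrightarrow> 0 \<le> A xs))"

definition regular_poly :: "nat \<Rightarrow> ('a::banach_lattice \<Rightarrow> real) \<Rightarrow> bool" where
  "regular_poly m P \<longleftrightarrow>
     (\<exists>P1 P2. positive_poly m P1 \<and> positive_poly m P2 \<and> P = (\<lambda>x. P1 x - P2 x))"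

definition poly_le :: "nat \<Rightarrow> ('a::banach_lattice \<Rightarrow> real) \<Rightarrow> ('a \<Rightarrow> real) \<Rightarrow> bool" where
  "poly_le m P Q \<longleftrightarrow> positive_poly m (\<lambda>x. Q x - P x)"


section \<open>The lattice of regular homogeneous polynomials\<close>

definition poly_sup :: "nat \<Rightarrow> ('a::banach_lattice \<Rightarrow> real) \<Rightarrow> ('a \<Rightarrow> real) \<Rightarrow> ('a \<Rightarrow> real)" where
  "poly_sup m P Q = (THE R. regular_poly m R \<and> poly_le m P R \<and> poly_le m Q R \<and>
     (\<forall>S. regular_poly m S \<and> poly_le m P S \<and> poly_le m Q S \<longrightarrow> poly_le m R S))"

definition poly_inf :: "nat \<Rightarrow> ('a::banach_lattice \<Rightarrow> real) \<Rightarrow> ('a \<Rightarrow> real) \<Rightarrow> ('a \<Rightarrow> real)" where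
  "poly_inf m P Q = (THE R. regular_poly m R \<and> poly_le m R P \<and> poly_le m R Q \<and>
     (\<forall>S. regular_poly m S \<and> poly_le m S P \<and> poly_le m S Q \<longrightarrow> poly_le m S R))"

definition poly_abs :: "nat \<Rightarrow> ('a::banach_lattice \<Rightarrow> real) \<Rightarrow> ('a \<Rightarrow> real)" where
  "poly_abs m P = poly_sup m P (\<lambda>x. - P x)"

definition poly_disjoint :: "nat \<Rightarrow> ('a::banach_lattice \<Rightarrow> real) \<Rightarrow> ('a \<Rightarrow> real) \<Rightarrow> bool" where
  "poly_disjoint m P Q \<longleftrightarrow> poly_inf m (poly_abs m P) (poly_abs m Q) = (\<lambda>x. 0)"

definition orthogonally_additive_poly :: "nat \<Rightarrow> ('a::banach_lattice \<Rightarrow> real) \<Rightarrow> bool" where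
  "orthogonally_additive_poly m P \<longleftrightarrow>
     regular_poly m P \<and> (\<forall>x y. disjoint_elts x y \<longrightarrow> P (x + y) = P x + P y)"

definition null_ideal :: "nat \<Rightarrow> ('a::banach_lattice \<Rightarrow> real) \<Rightarrow> 'a set" where
  "null_ideal m P = {x. poly_abs m P \<bar>x\<bar> = 0}"

definition poly_carrier :: "nat \<Rightarrow> ('a::banach_lattice \<Rightarrow> real) \<Rightarrow> 'a set" where
  "poly_carrier m P = disjoint_complement (null_ideal m P)"


section \<open>Nets and order continuity\<close>

definition directed_set :: "'i set \<Rightarrow> ('i \<Rightarrow> 'i \<Rightarrow> bool) \<Rightarrow> bool" where
  "directed_set I le \<longleftrightarrow>
     I \<noteq> {} \<and> (\<forall>a\<in>I. le a a) \<and>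
     (\<forall>a\<in>I. \<forall>b\<in>I. \<forall>c\<in>I. le a b \<and> le b c \<longrightarrow> le a c) \<and>
     (\<forall>a\<in>I. \<forall>b\<in>I. \<exists>c\<in>I. le a c \<and> le b c)"

definition tail_filter :: "'i set \<Rightarrow> ('i \<Rightarrow> 'i \<Rightarrow> bool) \<Rightarrow> 'i filter" where
  "tail_filter I le = (INF a\<in>I. principal {b\<in>I. le a b})"

definition decreases_to_0 ::
    "'i set \<Rightarrow> ('i \<Rightarrow> 'i \<Rightarrow> bool) \<Rightarrow> ('i \<Rightarrow> 'a::banach_lattice) \<Rightarrow> bool" where
  "decreases_to_0 I le y \<longleftrightarrow>
     (\<forall>a\<in>I. \<forall>b\<in>I. le a b \<longrightarrow> y b \<le> y a) \<and>
     (\<forall>a\<in>I. 0 \<le> y a) \<and> (\<forall>z. (\<forall>a\<in>I. z \<le> y a) \<longrightarrow> z \<le> 0)"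

definition order_converges ::
    "'i set \<Rightarrow> ('i \<Rightarrow> 'i \<Rightarrow> bool) \<Rightarrow> ('i \<Rightarrow> 'a::banach_lattice) \<Rightarrow> 'a \<Rightarrow> bool" where
  "order_converges I le u x \<longleftrightarrow>
     (\<exists>y. decreases_to_0 I le y \<and> (\<exists>a0\<in>I. \<forall>a\<in>I. le a0 a \<longrightarrow> \<bar>u a - x\<bar> \<le> y a))"

text \<open>A definition cannot quantify over all index types. Nets indexed by directed subsets
  of \<open>E \<times> E\<close> suffice: see \<open>order_continuous_at_iff\<close> below.\<close>

definition order_continuous_at :: "('a::banach_lattice \<Rightarrow> real) \<Rightarrow> 'a \<Rightarrow> bool" where
  "order_continuous_at P x \<longleftrightarrow>
     (\<forall>(I :: ('a \<times> 'a) set) le u. directed_set I le \<and> order_converges I le u x \<longrightarrow>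
        ((\<lambda>a. P (u a)) \<longlongrightarrow> P x) (tail_filter I le))"

definition order_continuous :: "('a::banach_lattice \<Rightarrow> real) \<Rightarrow> bool" where
  "order_continuous P \<longleftrightarrow> (\<forall>x. order_continuous_at P x)"

lemma directed_setD:
  assumes "directed_set I le"
  shows "I \<noteq> {}"
    and "\<lbrakk>a \<in> I; b \<in> I; c \<in> I; le a b; le b c\<rbrakk> \<Longrightarrow> le a c"
    and "\<lbrakk>a \<in> I; b \<in> I\<rbrakk> \<Longrightarrow> \<exists>c\<in>I. le a c \<and> le b c"
  using assms unfolding directed_set_def by blast+

lemma decreases_to_0D:
  assumes "decreases_to_0 I le y"
  shows "\<lbrakk>a \<in> I; b \<in> I; le a b\<rbrakk> \<Longrightarrow> y b \<le> y a"
    and "a \<in> I \<Longrightarrow> 0 \<le> y a"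
    and "(\<And>a. a \<in> I \<Longrightarrow> z \<le> y a) \<Longrightarrow> z \<le> 0"
  using assms unfolding decreases_to_0_def by blast+

lemma eventually_tail_filter:
  assumes "directed_set I le"
  shows "eventually R (tail_filter I le) \<longleftrightarrow> (\<exists>a\<in>I. \<forall>b\<in>I. le a b \<longrightarrow> R b)"
proof -
  have "eventually R (tail_filter I le) \<longleftrightarrow>
      (\<exists>a\<in>I. eventually R (principal {b\<in>I. le a b}))"
    unfolding tail_filter_def
  proof (rule eventually_INF_base)
    show "I \<noteq> {}" using assms by (rule directed_setD(1))
    fix a b assume ab: "a \<in> I" "b \<in> I"
    then obtain c where c: "c \<in> I" "le a c" "le b c"
      using directed_setD(3)[OF assms] by blast
    have "{d \<in> I. le c d} \<subseteq> {d \<in> I. le a d} \<inter> {d \<in> I. le b d}"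
      using directed_setD(2)[OF assms] ab c by blast
    then show "\<exists>x\<in>I. principal {b \<in> I. le x b} \<le>
        inf (principal {b \<in> I. le a b}) (principal {d \<in> I. le b d})"
      unfolding inf_principal using c(1) by (metis principal_le_iff)
  qed
  then show ?thesis by (auto simp: eventually_principal)
qed

lemma order_continuous_at_net:
  fixes P :: "'a::banach_lattice \<Rightarrow> real" and I :: "'i set"
  assumes oc: "order_continuous_at P x"
    and dir: "directed_set I le" and conv: "order_converges I le u x"
  shows "((\<lambda>a. P (u a)) \<longlongrightarrow> P x) (tail_filter I le)"
proof (rule ccontr)
  assume "\<not> ?thesis"
  then obtain e where e: "e > 0"
    "\<not> eventually (\<lambda>a. dist (P (u a)) (P x) < e) (tail_filter I le)"
    unfolding tendsto_iff by blast
  obtain y a0 where y: "decreases_to_0 I le y" and a0: "a0 \<in> I"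
    and bd: "\<And>a. a \<in> I \<Longrightarrow> le a0 a \<Longrightarrow> \<bar>u a - x\<bar> \<le> y a"
    using conv unfolding order_converges_def by blast
  define K where "K = {a\<in>I. le a0 a \<and> \<not> dist (P (u a)) (P x) < e}"
  have cofinal: "\<exists>k\<in>K. le a k" if "a \<in> I" for a
  proof -
    obtain c where c: "c \<in> I" "le a c" "le a0 c"
      using directed_setD(3)[OF dir \<open>a \<in> I\<close> a0] by blast
    then obtain k where k: "k \<in> I" "le c k" "\<not> dist (P (u k)) (P x) < e"
      using e(2) unfolding eventually_tail_filter[OF dir] by blast
    have "le a k" "le a0 k"
      using directed_setD(2)[OF dir] c k that a0 by blast+
    with k show ?thesis by (auto simp: K_def)
  qed
  have KI: "K \<subseteq> I" by (auto simp: K_def)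
  define J where "J = (\<lambda>a. (u a, y a)) ` K"
  define le' :: "'a \<times> 'a \<Rightarrow> 'a \<times> 'a \<Rightarrow> bool" where "le' = (\<lambda>p q. snd q \<le> snd p)"
  have dirJ: "directed_set J le'"
    unfolding directed_set_def
  proof (intro conjI ballI impI)
    show "J \<noteq> {}" using cofinal[OF a0] by (auto simp: J_def)
    fix p q assume "p \<in> J" "q \<in> J"
    then obtain a b where ab: "a \<in> K" "b \<in> K" "p = (u a, y a)" "q = (u b, y b)"
      by (auto simp: J_def)
    then obtain c where c: "c \<in> I" "le a c" "le b c"
      using directed_setD(3)[OF dir] KI by blast
    obtain k where k: "k \<in> K" "le c k" using cofinal[OF c(1)] by blast
    have "y k \<le> y c" "y c \<le> y a" "y c \<le> y b"
      using decreases_to_0D(1)[OF y] c k ab(1,2) KI by blast+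
    then have "le' p (u k, y k)" "le' q (u k, y k)"
      unfolding le'_def ab(3,4) snd_conv by (blast intro: order_trans)+
    then show "\<exists>r\<in>J. le' p r \<and> le' q r"
      using k(1) unfolding J_def by blast
  qed (auto simp: le'_def)
  have decJ: "decreases_to_0 J le' snd"
    unfolding decreases_to_0_def
  proof (intro conjI ballI allI impI)
    show "0 \<le> snd p" if "p \<in> J" for p
      using that decreases_to_0D(2)[OF y] KI by (auto simp: J_def)
    fix z assume z: "\<forall>p\<in>J. z \<le> snd p"
    have "z \<le> y a" if "a \<in> I" for a
    proof -
      obtain k where k: "k \<in> K" "le a k" using cofinal[OF \<open>a \<in> I\<close>] by blast
      then have "z \<le> y k" using z by (auto simp: J_def)
      also have "y k \<le> y a" using decreases_to_0D(1)[OF y] k KI that by blast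
      finally show ?thesis .
    qed
    then show "z \<le> 0" by (rule decreases_to_0D(3)[OF y])
  qed (auto simp: le'_def)
  have "order_converges J le' fst x"
  proof -
    obtain p where "p \<in> J" using directed_setD(1)[OF dirJ] by blast
    moreover have "\<bar>fst q - x\<bar> \<le> snd q" if "q \<in> J" for q
      using that bd by (auto simp: J_def K_def)
    ultimately show ?thesis using decJ unfolding order_converges_def by blast
  qed
  then have "((\<lambda>p. P (fst p)) \<longlongrightarrow> P x) (tail_filter J le')"
    using oc dirJ unfolding order_continuous_at_def by blast
  then have "eventually (\<lambda>p. dist (P (fst p)) (P x) < e) (tail_filter J le')"
    using e(1) unfolding tendsto_iff by blast
  then obtain p where "p \<in> J" "dist (P (fst p)) (P x) < e"
    unfolding eventually_tail_filter[OF dirJ] by (auto simp: le'_def)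
  then show False by (auto simp: J_def K_def)
qed

text \<open>The choice of index type is immaterial, as long as \<open>E \<times> E\<close> embeds into it.\<close>

lemma order_continuous_at_iff:
  fixes P :: "'a::banach_lattice \<Rightarrow> real" and emb :: "'a \<times> 'a \<Rightarrow> 'i"
  assumes emb: "inj emb"
  shows "order_continuous_at P x \<longleftrightarrow>
     (\<forall>(I :: 'i set) le u. directed_set I le \<and> order_converges I le u x \<longrightarrow>
        ((\<lambda>a. P (u a)) \<longlongrightarrow> P x) (tail_filter I le))"
    (is "_ \<longleftrightarrow> ?R")
proof
  assume "order_continuous_at P x"
  then show ?R using order_continuous_at_net by blast
next
  assume R: ?R
  show "order_continuous_at P x"
    unfolding order_continuous_at_def
  proof (intro allI impI, elim conjE)
    fix I :: "('a \<times> 'a) set" and le u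
    assume dir: "directed_set I le" and conv: "order_converges I le u x"
    define g where "g = inv emb"
    have g [simp]: "g (emb a) = a" for a using emb by (simp add: g_def)
    let ?I = "emb ` I" and ?le = "\<lambda>a b. le (g a) (g b)"
    have dir': "directed_set ?I ?le"
      using dir unfolding directed_set_def ball_simps bex_simps image_is_empty g by blast
    obtain y where "decreases_to_0 I le y"
      "\<exists>a0\<in>I. \<forall>a\<in>I. le a0 a \<longrightarrow> \<bar>u a - x\<bar> \<le> y a"
      using conv unfolding order_converges_def by blast
    then have "order_converges ?I ?le (u \<circ> g) x"
      unfolding order_converges_def decreases_to_0_def
      by (intro exI[of _ "y \<circ> g"]) simp
    with R dir' have "((\<lambda>a. P ((u \<circ> g) a)) \<longlongrightarrow> P x) (tail_filter ?I ?le)" by blast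
    then show "((\<lambda>a. P (u a)) \<longlongrightarrow> P x) (tail_filter I le)"
      unfolding tendsto_iff eventually_tail_filter[OF dir] eventually_tail_filter[OF dir']
      by simp
  qed
qed

end

(* The symmetric form A of an orthogonally additive polynomial P vanishes on lists containing two
   disjoint elements. For such orthosymmetric forms the modulus can be computed in a single slot on
   the cone: it is the modulus of the linear functional A(., x_2, ..., x_m), which is additive in x_2
   because on the pieces of a suitable partition x_2 is nearly a multiple of a fixed e. Fixing x >= 0
   reduces everything to the functionals f = |A|(., x, ..., x) and g, its analogue for Q, and to
   Nakano's argument. If P and Q are disjoint, there are y_i in [0, x] with g(y_i) + f(x - y_i) small;
   for x in C(Q) the infima of y_0, ..., y_i decrease to 0, so order continuity of f gives f(x) = 0.
   Hence C(Q) is contained in N(P), which is disjoint from C(P). Conversely, if the carriers are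
   disjoint, let K be the form of the infimum of |P| and |Q|. The null ideal of K(., x, ..., x)
   contains N(P) and N(Q), so its disjoint complement is trivial, and order continuity of |P| gives
   K(x, ..., x) = 0. *)
theory Submission
  imports Defs
begin

section \<open>Banach lattices\<close>

text \<open>E need not be Dedekind complete, so no band projections are at hand. Exact
  decompositions are replaced by the truncations \<open>inf x y\<close> and
  \<open>pprt (x - y)\<close>, often with errors of order \<epsilon> e for a fixed e dominating the
  elements involved, and only suprema of real numbers are formed. For a general regular m-linear
  form the modulus has to be computed with partitions in all slots at once. The one-slot formula is
  linear in its own slot and minimal by the scalar theory of functionals; the obstacle is its
  symmetry, that is, that the chosen slot does not matter, and this is what additivity in x_2
  settles. Order continuity is assumed of P but needed for |A|(., x, ..., x). The bridge has two
  halves: m A(u, x, ..., x) is the first-order coefficient of P(x + t u) in t, and a functional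
  passes its order continuity on to its modulus. In the converse direction N(P) and N(Q) are defined
  by diagonal values, whereas the argument runs in functionals with x frozen; an absolute continuity
  argument based on orthosymmetry connects the two.\<close>

lemma archimedean_zero:
  fixes x y :: "'a::banach_lattice"
  assumes "0 \<le> x" and "\<And>n::nat. real n *\<^sub>R x \<le> y"
  shows "x = 0"
proof (rule ccontr)
  assume "x \<noteq> 0"
  then obtain n :: nat where n: "norm y < real n * norm x"
    using reals_Archimedean3[of "norm x"] by auto
  have "0 \<le> real n *\<^sub>R x" using assms(1) by (simp add: scaleR_nonneg_nonneg)
  then have "\<bar>real n *\<^sub>R x\<bar> \<le> \<bar>y\<bar>" using assms(2)[of n] by (metis abs_of_nonneg order_trans)
  then have "norm (real n *\<^sub>R x) \<le> norm y" by (rule norm_mono)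
  with n show False by simp
qed

lemma pprt_diff: "x = pprt x - pprt (- x)" for x :: "'a::banach_lattice"
  using prts[of x] by (simp add: pprt_neg)

lemma abs_eq_pprt_add: "\<bar>x\<bar> = pprt x + pprt (- x)" for x :: "'a::banach_lattice"
  using abs_prts[of x] by (simp add: pprt_neg)

text \<open>Truncation at y, the substitute for a band projection: x is cut into a part below y and
  an excess, and by \<open>inf_pprt_neg\<close> the excess is disjoint from
  \<open>pprt (y - x)\<close>.\<close>

lemma eq_inf_add_pprt: "x = inf x y + pprt (x - y)" for x y :: "'a::banach_lattice"
proof -
  have "pprt (x - y) + y = sup x y"
    unfolding pprt_def add_sup_distrib_right by simp
  then show ?thesis using add_eq_inf_sup[of x y] by (metis add.assoc add.commute add_right_cancel)
qed

lemma inf_pprt_neg: "inf (pprt x) (pprt (- x)) = 0" for x :: "'a::banach_lattice"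
proof -
  have "inf (pprt x) (pprt (- x)) = pprt (-x) + inf x 0"
    using pprt_diff[of x] by (metis add.commute add_0 add_inf_distrib_left diff_add_cancel)
  then show ?thesis by (simp add: pprt_neg flip: nprt_def)
qed

lemma inf_add_le:
  fixes a b c :: "'a::banach_lattice"
  assumes "0 \<le> a" "0 \<le> b" "0 \<le> c"
  shows "inf (a + b) c \<le> inf a c + inf b c"
proof -
  have "inf (a + b) c \<le> a + inf b c"
    unfolding add_inf_distrib_left using assms by (intro inf_mono) auto
  moreover have "inf (a + b) c \<le> c + inf b c"
    using assms by (metis add_increasing2 inf.coboundedI2 inf.boundedI order_refl)
  ultimately show ?thesis unfolding add_inf_distrib_right by simp
qed

lemma inf_zero_mono:
  fixes u v u' v' :: "'a::banach_lattice"
  assumes "inf u v = 0" "0 \<le> u'" "u' \<le> u" "0 \<le> v'" "v' \<le> v"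
  shows "inf u' v' = 0"
  using assms by (metis antisym inf_mono le_inf_iff)

lemma inf_zero_add:
  fixes u v w :: "'a::banach_lattice"
  assumes "inf u w = 0" "inf v w = 0"
  shows "inf (u + v) w = 0"
proof -
  have p: "0 \<le> u" "0 \<le> v" "0 \<le> w" using assms by (metis inf.cobounded1 inf.cobounded2)+
  then have "inf (u + v) w \<le> 0" using inf_add_le[of u v w] assms by simp
  moreover have "0 \<le> inf (u + v) w" using p by simp
  ultimately show ?thesis by simp
qed

lemma inf_zero_scaleR:
  fixes u v :: "'a::banach_lattice"
  assumes "inf u v = 0" "0 \<le> c"
  shows "inf (c *\<^sub>R u) v = 0"
proof -
  have p: "0 \<le> u" "0 \<le> v" using assms by (metis inf.cobounded1 inf.cobounded2)+
  define t where "t = inf (c *\<^sub>R u) v"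
  \<comment> \<open>Since d \<ge> 1, also v \<le> d v, so t / d lies below both u and v.\<close>
  define d where "d = max c 1"
  have d: "d \<ge> 1" "d > 0" "c \<le> d" by (auto simp: d_def)
  have t0: "0 \<le> t" using p assms(2) by (simp add: t_def scaleR_nonneg_nonneg)
  have "t \<le> c *\<^sub>R u" "t \<le> v" by (simp_all add: t_def)
  moreover have "c *\<^sub>R u \<le> d *\<^sub>R u" using p d by (intro scaleR_right_mono) auto
  moreover have "v \<le> d *\<^sub>R v" using scaleR_right_mono[of 1 d v] d p by simp
  ultimately have "t \<le> d *\<^sub>R u" "t \<le> d *\<^sub>R v" by (blast intro: order_trans)+
  then have "(1/d) *\<^sub>R t \<le> u" "(1/d) *\<^sub>R t \<le> v"
    using d scaleR_left_mono[of t "d *\<^sub>R u" "1/d"] scaleR_left_mono[of t "d *\<^sub>R v" "1/d"] by simp_all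
  then have "(1/d) *\<^sub>R t \<le> 0" using assms(1) by (metis le_inf_iff)
  then have "t \<le> 0" using d scaleR_left_mono[of "(1/d) *\<^sub>R t" 0 d] by simp
  with t0 have "t = 0" by (rule antisym[rotated])
  then show ?thesis by (simp add: t_def)
qed

lemma pprt_scaleR:
  fixes x :: "'a::banach_lattice"
  assumes "0 < c"
  shows "pprt (c *\<^sub>R x) = c *\<^sub>R pprt x"
proof (rule antisym)
  show "pprt (c *\<^sub>R x) \<le> c *\<^sub>R pprt x"
    unfolding pprt_def using assms by (auto intro!: scaleR_left_mono scaleR_nonneg_nonneg)
  have "x \<le> (1/c) *\<^sub>R pprt (c *\<^sub>R x)" 
    using assms scaleR_left_mono[of "c *\<^sub>R x" "pprt (c *\<^sub>R x)" "1/c"] by (simp add: pprt_def)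
  moreover have "0 \<le> (1/c) *\<^sub>R pprt (c *\<^sub>R x)" using assms by (simp add: scaleR_nonneg_nonneg)
  ultimately have "pprt x \<le> (1/c) *\<^sub>R pprt (c *\<^sub>R x)" by (simp add: pprt_def)
  then show "c *\<^sub>R pprt x \<le> pprt (c *\<^sub>R x)"
    using assms scaleR_left_mono[of "pprt x" "(1/c) *\<^sub>R pprt (c *\<^sub>R x)" c] by simp
qed

text \<open>Truncation of a signed element to [-y, y], done separately on positive and negative
  part. Both parts lie below |z|, and a difference of two elements of [0, c] has modulus at most
  c.\<close>

lemma clip_abs:
  fixes y z :: "'a::banach_lattice"
  assumes "0 \<le> y"
  shows "\<bar>inf (pprt z) y - inf (pprt (- z)) y\<bar> \<le> inf \<bar>z\<bar> y"
    and "\<bar>pprt (pprt z - y) - pprt (pprt (- z) - y)\<bar> \<le> pprt (\<bar>z\<bar> - y)"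
    and "z = (inf (pprt z) y - inf (pprt (- z)) y) + (pprt (pprt z - y) - pprt (pprt (- z) - y))"
proof -
  have zz: "pprt z \<le> \<bar>z\<bar>" "pprt (- z) \<le> \<bar>z\<bar>" by (simp_all add: abs_eq_pprt_add)
  have diff: "\<bar>a - b\<bar> \<le> c" if "0 \<le> a" "0 \<le> b" "a \<le> c" "b \<le> c" for a b c :: 'a
  proof -
    have "a - b \<le> a" "b - a \<le> b" using that by simp_all
    then have "a - b \<le> c" "- (a - b) \<le> c"
      unfolding minus_diff_eq using that by (blast intro: order_trans)+
    then show ?thesis by (rule abs_leI)
  qed
  show "\<bar>inf (pprt z) y - inf (pprt (- z)) y\<bar> \<le> inf \<bar>z\<bar> y"
    using zz assms by (intro diff) (auto intro: le_infI1)
  show "\<bar>pprt (pprt z - y) - pprt (pprt (- z) - y)\<bar> \<le> pprt (\<bar>z\<bar> - y)"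
    using zz by (intro diff) (auto intro!: pprt_mono)
  show "z = (inf (pprt z) y - inf (pprt (- z)) y) + (pprt (pprt z - y) - pprt (pprt (- z) - y))"
  proof -
    have "z = (inf (pprt z) y + pprt (pprt z - y)) - (inf (pprt (- z)) y + pprt (pprt (- z) - y))"
      unfolding eq_inf_add_pprt[symmetric] by (rule pprt_diff)
    then show ?thesis by (simp only: add_diff_add)
  qed
qed

text \<open>The last summand takes as much of y as it can, \<open>inf y (p (Suc n))\<close>; the
  excess of y over it lies below the sum of the others.\<close>

lemma riesz_decomposition_sum:
  fixes p :: "nat \<Rightarrow> 'a::banach_lattice"
  assumes "\<And>i. i \<le> n \<Longrightarrow> 0 \<le> p i" "0 \<le> y" "y \<le> (\<Sum>i\<le>n. p i)"
  shows "\<exists>q. (\<forall>i\<le>n. 0 \<le> q i \<and> q i \<le> p i) \<and> (\<Sum>i\<le>n. q i) = y"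
  using assms
proof (induction n arbitrary: y)
  case 0
  then show ?case by (intro exI[of _ "\<lambda>_. y"]) auto
next
  case (Suc n)
  let ?y = "pprt (y - p (Suc n))"
  have "y - p (Suc n) \<le> (\<Sum>i\<le>n. p i)" using Suc.prems(3) by (simp add: algebra_simps)
  moreover have "0 \<le> (\<Sum>i\<le>n. p i)" using Suc.prems(1) by (intro sum_nonneg) auto
  ultimately have "?y \<le> (\<Sum>i\<le>n. p i)" by (simp add: pprt_def)
  then obtain q where q: "\<And>i. i \<le> n \<Longrightarrow> 0 \<le> q i \<and> q i \<le> p i" "(\<Sum>i\<le>n. q i) = ?y"
    using Suc.IH[of ?y] Suc.prems(1) by auto
  define q' where "q' = q(Suc n := inf y (p (Suc n)))"
  have "(\<Sum>i\<le>n. q' i) = (\<Sum>i\<le>n. q i)" by (intro sum.cong) (auto simp: q'_def)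
  then have "(\<Sum>i\<le>Suc n. q' i) = y"
    using q(2) eq_inf_add_pprt[of y "p (Suc n)"] by (simp add: q'_def add.commute)
  moreover have "\<forall>i\<le>Suc n. 0 \<le> q' i \<and> q' i \<le> p i"
    using q(1) Suc.prems by (auto simp: q'_def le_Suc_eq)
  ultimately show ?case by blast
qed

section \<open>The modulus of a linear functional\<close>

text \<open>On the cone this is the Riesz-Kantorovich formula for |h|(y). Off the cone the set is
  empty and the value carries no meaning.\<close>

definition functional_modulus :: "('a::banach_lattice \<Rightarrow> real) \<Rightarrow> 'a \<Rightarrow> real" where
  "functional_modulus h y = (SUP z\<in>{z. \<bar>z\<bar> \<le> y}. h z)"

text \<open>g certifies that h is order bounded, so that the supremum in
  \<open>functional_modulus\<close> is finite; the modulus does not depend on the choice of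
  g.\<close>

definition dominated :: "('a::banach_lattice \<Rightarrow> real) \<Rightarrow> ('a \<Rightarrow> real) \<Rightarrow> bool" where
  "dominated h g \<longleftrightarrow> linear h \<and> linear g \<and> (\<forall>z\<ge>0. \<bar>h z\<bar> \<le> g z)"

lemma linear_mono_cone:
  fixes g :: "'a::banach_lattice \<Rightarrow> real"
  assumes "linear g" "\<And>z. 0 \<le> z \<Longrightarrow> 0 \<le> g z" "x \<le> y"
  shows "g x \<le> g y"
  using assms(2)[of "y - x"] assms(1,3) by (simp add: linear_diff)

lemma dominated_nonneg: "dominated h g \<Longrightarrow> 0 \<le> z \<Longrightarrow> 0 \<le> g z"
  unfolding dominated_def by (metis abs_ge_zero order_trans)

lemma dominated_abs:
  assumes "dominated h g"
  shows "\<bar>h z\<bar> \<le> g \<bar>z\<bar>"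
proof -
  have l: "linear h" "linear g" using assms by (auto simp: dominated_def)
  have "h z = h (pprt z) - h (pprt (- z))"
    using l(1) pprt_diff[of z] by (metis linear_diff)
  moreover have "\<bar>h (pprt z)\<bar> \<le> g (pprt z)" "\<bar>h (pprt (- z))\<bar> \<le> g (pprt (- z))"
    using assms by (auto simp: dominated_def)
  moreover have "g \<bar>z\<bar> = g (pprt z) + g (pprt (- z))"
    using l(2) by (simp add: abs_eq_pprt_add linear_add)
  ultimately show ?thesis by linarith
qed

lemma dominated_le:
  assumes "dominated h g" "\<bar>z\<bar> \<le> y"
  shows "\<bar>h z\<bar> \<le> g y"
proof -
  have "g \<bar>z\<bar> \<le> g y"
    using assms by (intro linear_mono_cone dominated_nonneg) (auto simp: dominated_def)
  with dominated_abs[OF assms(1), of z] show ?thesis by linarith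
qed

lemma dominated_add:
  "dominated h g \<Longrightarrow> dominated h' g' \<Longrightarrow> dominated (\<lambda>z. h z + h' z) (\<lambda>z. g z + g' z)"
  unfolding dominated_def by (fastforce intro: linear_compose_add abs_triangle_ineq[THEN order_trans])

lemma dominated_cmult:
  assumes "dominated h g" "0 \<le> c"
  shows "dominated (\<lambda>z. c * h z) (\<lambda>z. c * g z)"
proof -
  have "linear (\<lambda>z. c * f z)" if "linear f" for f :: "'a \<Rightarrow> real"
    using that by (intro linearI) (simp_all add: linear_add linear_scale algebra_simps)
  then show ?thesis
    using assms unfolding dominated_def by (auto simp: abs_mult intro: mult_left_mono)
qed

lemma functional_modulus_upper:
  assumes "dominated h g" "\<bar>z\<bar> \<le> y"
  shows "h z \<le> functional_modulus h y"
  unfolding functional_modulus_def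
proof (rule cSUP_upper)
  show "bdd_above (h ` {z. \<bar>z\<bar> \<le> y})"
    using dominated_le[OF assms(1)] by (intro bdd_aboveI2[of _ _ "g y"]) (auto simp: abs_le_iff)
qed (use assms in simp)

lemma functional_modulus_least:
  assumes "0 \<le> y" "\<And>z. \<bar>z\<bar> \<le> y \<Longrightarrow> h z \<le> c"
  shows "functional_modulus h y \<le> c"
  unfolding functional_modulus_def using assms by (intro cSUP_least) (auto intro!: exI[of _ 0])

lemma functional_modulus_approx:
  assumes "0 \<le> y" "0 < \<epsilon>"
  shows "\<exists>z. \<bar>z\<bar> \<le> y \<and> functional_modulus h y - \<epsilon> < h z"
proof (rule ccontr)
  assume "\<not> ?thesis"
  then have "functional_modulus h y \<le> functional_modulus h y - \<epsilon>"
    using assms(1) by (intro functional_modulus_least) (auto simp: not_less)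
  with assms(2) show False by simp
qed

lemma functional_modulus_perturb:
  assumes "dominated h' g'" "0 \<le> y" "\<And>z. \<bar>z\<bar> \<le> y \<Longrightarrow> h z \<le> h' z + \<delta>"
  shows "functional_modulus h y \<le> functional_modulus h' y + \<delta>"
proof (rule functional_modulus_least[OF assms(2)])
  fix z assume "\<bar>z\<bar> \<le> y"
  with assms(3) functional_modulus_upper[OF assms(1)] show "h z \<le> functional_modulus h' y + \<delta>"
    by (smt (verit))
qed

lemma functional_modulus_le:
  assumes "dominated h g" "0 \<le> y"
  shows "functional_modulus h y \<le> g y"
  using assms dominated_le[OF assms(1)] by (intro functional_modulus_least) (auto simp: abs_le_iff)

lemma functional_modulus_ge_abs:
  assumes "dominated h g" "\<bar>z\<bar> \<le> y"
  shows "\<bar>h z\<bar> \<le> functional_modulus h y"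
proof -
  have "h (- z) = - h z" using assms(1) by (simp add: dominated_def linear_neg)
  then show ?thesis
    using functional_modulus_upper[OF assms(1), of z y] functional_modulus_upper[OF assms(1), of "- z" y] assms(2)
    by simp
qed

lemma functional_modulus_nonneg: "dominated h g \<Longrightarrow> 0 \<le> y \<Longrightarrow> 0 \<le> functional_modulus h y"
  using functional_modulus_ge_abs[of h g 0 y] by simp

text \<open>Truncating z at x writes an element of [-(x + y), x + y] as one of [-x, x] plus one of
  [-y, y]; this gives subadditivity, while sums of near-maximizers give the converse.\<close>

lemma functional_modulus_add:
  assumes "dominated h g" "0 \<le> x" "0 \<le> y"
  shows "functional_modulus h (x + y) = functional_modulus h x + functional_modulus h y"
proof (rule antisym)
  have lin: "linear h" using assms by (simp add: dominated_def)
  show "functional_modulus h (x + y) \<le> functional_modulus h x + functional_modulus h y"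
  proof (rule functional_modulus_least)
    fix z assume z: "\<bar>z\<bar> \<le> x + y"
    let ?u = "inf (pprt z) x - inf (pprt (- z)) x"
    let ?v = "pprt (pprt z - x) - pprt (pprt (- z) - x)"
    have "\<bar>?u\<bar> \<le> x" using clip_abs(1)[OF assms(2), of z] by simp
    moreover have "\<bar>?v\<bar> \<le> y"
    proof -
      have "\<bar>z\<bar> - x \<le> y" using z by (simp add: algebra_simps)
      then have "pprt (\<bar>z\<bar> - x) \<le> y" using assms(3) by (simp add: pprt_def)
      then show ?thesis using clip_abs(2)[OF assms(2), of z] by (rule order_trans[rotated])
    qed
    moreover have "h z = h ?u + h ?v" using clip_abs(3)[OF assms(2), of z] linear_add[OF lin] by metis
    ultimately show "h z \<le> functional_modulus h x + functional_modulus h y"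
      using functional_modulus_upper[OF assms(1)] by (smt (verit))
  qed (use assms in simp)
  show "functional_modulus h x + functional_modulus h y \<le> functional_modulus h (x + y)"
  proof (rule field_le_epsilon)
    fix \<epsilon> :: real assume "0 < \<epsilon>"
    then obtain u v where uv: "\<bar>u\<bar> \<le> x" "functional_modulus h x - \<epsilon>/2 < h u"
        "\<bar>v\<bar> \<le> y" "functional_modulus h y - \<epsilon>/2 < h v"
      using functional_modulus_approx[OF assms(2), of "\<epsilon>/2" h] functional_modulus_approx[OF assms(3), of "\<epsilon>/2" h] by auto
    have "\<bar>u + v\<bar> \<le> x + y" using uv(1,3) by (meson abs_triangle_ineq add_mono order_trans)
    then have "h u + h v \<le> functional_modulus h (x + y)"
      using functional_modulus_upper[OF assms(1)] linear_add[OF lin] by metis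
    with uv show "functional_modulus h x + functional_modulus h y \<le> functional_modulus h (x + y) + \<epsilon>" by linarith
  qed
qed

lemma functional_modulus_0: "dominated h g \<Longrightarrow> functional_modulus h 0 = 0"
  using functional_modulus_add[of h g 0 0] by simp

lemma functional_modulus_sum:
  assumes "dominated h g" "\<And>i. i \<in> I \<Longrightarrow> 0 \<le> q i"
  shows "functional_modulus h (\<Sum>i\<in>I. q i) = (\<Sum>i\<in>I. functional_modulus h (q i))"
  using assms(2)
proof (induction I rule: infinite_finite_induct)
  case (insert i I)
  then show ?case by (simp add: functional_modulus_add[OF assms(1)] sum_nonneg)
qed (simp_all add: functional_modulus_0[OF assms(1)])

lemma functional_modulus_cmult:
  assumes "dominated h g" "0 \<le> y" "0 \<le> c"
  shows "functional_modulus (\<lambda>z. c * h z) y = c * functional_modulus h y"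
proof (cases "c = 0")
  case True
  have "(\<lambda>z. c * h z) ` {z. \<bar>z\<bar> \<le> y} = {0}" using assms(2) True by (auto intro!: image_eqI[of _ _ 0])
  then show ?thesis using True by (simp add: functional_modulus_def)
next
  case False
  then have c: "0 < c" using assms(3) by simp
  have "functional_modulus (\<lambda>z. c * h z) y \<le> c * functional_modulus h y"
    using c assms(2) functional_modulus_upper[OF assms(1)] by (intro functional_modulus_least) simp_all
  moreover have "functional_modulus h y \<le> functional_modulus (\<lambda>z. c * h z) y / c"
    using c assms(2) functional_modulus_upper[OF dominated_cmult[OF assms(1,3)]]
    by (intro functional_modulus_least) (simp_all add: field_simps)
  ultimately show ?thesis using c by (simp add: field_simps)
qed

lemma functional_modulus_scaleR:
  assumes "dominated h g" "0 \<le> y" "0 \<le> c"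
  shows "functional_modulus h (c *\<^sub>R y) = c * functional_modulus h y"
proof (cases "c = 0")
  case True
  then show ?thesis by (simp add: functional_modulus_0[OF assms(1)])
next
  case False
  then have c: "0 < c" using assms(3) by simp
  have lin: "linear h" using assms by (simp add: dominated_def)
  have le: "functional_modulus h (d *\<^sub>R x) \<le> d * functional_modulus h x" if "0 < d" "0 \<le> x" for d x
  proof (rule functional_modulus_least)
    fix z assume z: "\<bar>z\<bar> \<le> d *\<^sub>R x"
    have "(1/d) *\<^sub>R z \<le> x" "(1/d) *\<^sub>R (- z) \<le> x"
      using that z scaleR_left_mono[of z "d *\<^sub>R x" "1/d"] scaleR_left_mono[of "-z" "d *\<^sub>R x" "1/d"]
      by (simp_all add: abs_le_iff)
    then have "\<bar>(1/d) *\<^sub>R z\<bar> \<le> x" by (intro abs_leI) simp_all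
    then have "h ((1/d) *\<^sub>R z) \<le> functional_modulus h x" by (rule functional_modulus_upper[OF assms(1)])
    then show "h z \<le> d * functional_modulus h x" using that lin by (simp add: linear_scale field_simps)
  qed (use that in \<open>simp add: scaleR_nonneg_nonneg\<close>)
  have "functional_modulus h y \<le> (1/c) * functional_modulus h (c *\<^sub>R y)"
    using le[of "1/c" "c *\<^sub>R y"] c assms(2) by (simp add: scaleR_nonneg_nonneg)
  with le[OF c assms(2)] c show ?thesis by (simp add: field_simps)
qed


section \<open>Orthosymmetric bilinear forms\<close>

text \<open>The disjointness says that on the piece \<open>q i\<close> the element \<open>n x\<close> differs from \<open>i e\<close> by at
  most \<open>e\<close>.\<close>

lemma tent_partition:
  fixes x y e :: "'a::banach_lattice"
  assumes "0 \<le> x" "x \<le> e" "0 \<le> y" "y \<le> e"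
  shows "\<exists>q. (\<forall>i\<le>n. 0 \<le> q i) \<and> (\<Sum>i\<le>n. q i) = y \<and>
      (\<forall>i\<le>n. inf (q i) (pprt (\<bar>real n *\<^sub>R x - real i *\<^sub>R e\<bar> - e)) = 0)"
proof -
  have e: "0 \<le> e" using assms by order
  \<comment> \<open>Think of functions and put r = n x / e, with values in [0, n]. In units of e,
    \<open>s i\<close> is r - (i - 1) clamped to [0, 1], and \<open>p i\<close> is the tent of
    height 1 centred at r = i and supported in |r - i| \<le> 1. The sum telescopes from
    \<open>s 0\<close> = e to \<open>s (Suc n)\<close> = 0.\<close>
  define d where "d i = real n *\<^sub>R x - real i *\<^sub>R e" for i :: nat
  define s where "s i = inf (pprt (d i + e)) e" for i
  define p where "p i = s i - s (Suc i)" for i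
  have dS: "d (Suc i) + e = d i" for i by (simp add: d_def algebra_simps)
  have p0: "0 \<le> p i" for i
  proof -
    have "inf (pprt (d i)) e \<le> inf (pprt (d i + e)) e" using e by (intro inf_mono pprt_mono) simp_all
    then show ?thesis by (simp only: p_def s_def dS diff_ge_0_iff_ge)
  qed
  have nx: "0 \<le> real n *\<^sub>R x" using assms(1) by (simp add: scaleR_nonneg_nonneg)
  have "e \<le> d 0 + e" using nx by (simp add: d_def)
  then have s0: "s 0 = e" unfolding s_def by (metis e inf.absorb2 order_trans pprt_eq_id)
  have "d n \<le> 0" using assms(2) by (simp add: d_def scaleR_left_mono)
  then have sn: "s (Suc n) = 0" unfolding s_def dS using e by (simp add: inf.absorb1)
  have "(\<Sum>i\<le>n. p i) = e" unfolding p_def sum_telescope using s0 sn by simp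
  then obtain q where q: "\<And>i. i \<le> n \<Longrightarrow> 0 \<le> q i \<and> q i \<le> p i" "(\<Sum>i\<le>n. q i) = y"
    using riesz_decomposition_sum[of n p y] p0 assms(3,4) by auto
  \<comment> \<open>The support of the tent: \<open>p i\<close> lies below the positive part of d i
    + e and below the negative part of d i - e, and |d i| - e is positive only beyond one of these
    two edges.\<close>
  have "inf (q i) (pprt (\<bar>d i\<bar> - e)) = 0" if "i \<le> n" for i
  proof -
    have pos: "0 \<le> inf (pprt (d i)) e" using e by simp
    have "inf (pprt (d i + e)) e - inf (pprt (d i)) e \<le> inf (pprt (d i + e)) e - 0"
      using pos by (rule diff_left_mono)
    then have "p i \<le> inf (pprt (d i + e)) e" by (simp only: p_def s_def dS diff_zero)
    then have "p i \<le> pprt (d i + e)" by simp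
    then have 1: "inf (p i) (pprt (- (d i + e))) = 0"
      by (intro inf_zero_mono[OF inf_pprt_neg[of "d i + e"]] p0) simp_all
    have "p i \<le> e - inf (pprt (d i)) e" unfolding p_def s_def dS by simp
    also have "\<dots> = sup (e - pprt (d i)) 0" by (simp add: diff_inf_eq_sup add_sup_distrib_left)
    also have "\<dots> \<le> pprt (- (d i - e))" unfolding pprt_def by (intro sup_mono) simp_all
    finally have "p i \<le> pprt (- (d i - e))" .
    then have 2: "inf (p i) (pprt (d i - e)) = 0"
      by (intro inf_zero_mono[OF inf_pprt_neg[of "- (d i - e)"]] p0) simp_all
    have 3: "inf (pprt (d i - e) + pprt (- (d i + e))) (p i) = 0"
      using 1 2 by (intro inf_zero_add) (simp_all only: inf.commute)
    have "\<bar>d i\<bar> - e \<le> pprt (d i - e) + pprt (- (d i + e))"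
    proof -
      have "d i - e \<le> pprt (d i - e)" "- (d i + e) \<le> pprt (- (d i + e))" by (simp_all add: pprt_def)
      then have "d i - e \<le> pprt (d i - e) + pprt (- (d i + e))" "- d i - e \<le> pprt (d i - e) + pprt (- (d i + e))"
        by (simp_all add: add_increasing add_increasing2)
      then have "\<bar>d i\<bar> \<le> (pprt (d i - e) + pprt (- (d i + e))) + e"
        by (intro abs_leI) (simp_all only: diff_le_eq)
      then show ?thesis by (simp only: diff_le_eq)
    qed
    then have "pprt (\<bar>d i\<bar> - e) \<le> pprt (d i - e) + pprt (- (d i + e))"
      by (subst pprt_def) simp
    then show ?thesis
      using q(1)[OF that] by (intro inf_zero_mono[OF 3[unfolded inf.commute[of _ "p i"]]]) auto
  qed
  then show ?thesis using q unfolding d_def by blast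
qed

text \<open>To be instantiated with the first two slots of a form, the remaining entries being
  frozen in the cone; \<open>b\<close> comes from the dominating form.\<close>

locale orthosymmetric_bilinear =
  fixes a b :: "'a::banach_lattice \<Rightarrow> 'a \<Rightarrow> real"
  assumes bilinear_a: "bilinear a" and bilinear_b: "bilinear b"
    and dom: "\<And>z x. 0 \<le> z \<Longrightarrow> 0 \<le> x \<Longrightarrow> \<bar>a z x\<bar> \<le> b z x"
    and orthosym: "\<And>z x. inf z x = 0 \<Longrightarrow> a z x = 0"
begin

lemma dominated_right: "0 \<le> x \<Longrightarrow> dominated (\<lambda>z. a z x) (\<lambda>z. b z x)"
  using bilinear_a bilinear_b dom unfolding dominated_def bilinear_def by auto

lemma dominated_left: "0 \<le> z \<Longrightarrow> dominated (a z) (b z)"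
  using bilinear_a bilinear_b dom unfolding dominated_def bilinear_def by auto

lemma abs_le:
  assumes "\<bar>z\<bar> \<le> z'" "\<bar>x\<bar> \<le> x'"
  shows "\<bar>a z x\<bar> \<le> b z' x'"
proof -
  have z: "0 \<le> z'" and x: "0 \<le> x'" using assms by (meson abs_ge_zero order_trans)+
  have "dominated (\<lambda>z. a z x) (\<lambda>z. b z x')"
    using bilinear_a bilinear_b dominated_le[OF dominated_left assms(2)] unfolding dominated_def bilinear_def by blast
  then show ?thesis using assms(1) by (rule dominated_le)
qed

lemma orthosym_abs:
  assumes "inf \<bar>z\<bar> \<bar>x\<bar> = 0"
  shows "a z x = 0"
proof -
  have 0: "inf u v = 0" if "u \<in> {pprt z, pprt (- z)}" "v \<in> {pprt x, pprt (- x)}" for u v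
    using that by (intro inf_zero_mono[OF assms]) (auto simp: abs_eq_pprt_add)
  have "a z x = a (pprt z - pprt (- z)) (pprt x - pprt (- x))"
    unfolding pprt_diff[symmetric] ..
  also have "\<dots> = 0"
    using 0 orthosym by (simp add: bilinear_lsub[OF bilinear_a] bilinear_rsub[OF bilinear_a])
  finally show ?thesis .
qed

text \<open>The excess of |n x - i e| over e is disjoint from q, so orthosymmetry removes it from
  the second slot; what remains of n x - i e has modulus at most e. Dividing by n gives the
  bound.\<close>

lemma tent_approx:
  assumes "0 \<le> e" "0 < n" "\<bar>z\<bar> \<le> q" "inf q (pprt (\<bar>real n *\<^sub>R x - i *\<^sub>R e\<bar> - e)) = 0"
  shows "\<bar>a z x - (i / real n) * a z e\<bar> \<le> b q e / real n"
proof -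
  let ?d = "real n *\<^sub>R x - i *\<^sub>R e"
  let ?c = "inf (pprt ?d) e - inf (pprt (- ?d)) e" and ?r = "pprt (pprt ?d - e) - pprt (pprt (- ?d) - e)"
  have "a z ?d = a z ?c + a z ?r"
    using clip_abs(3)[OF assms(1), of ?d] bilinear_radd[OF bilinear_a] by metis
  moreover have "a z ?r = 0"
    using clip_abs(2)[OF assms(1), of ?d] assms(3)
    by (intro orthosym_abs inf_zero_mono[OF assms(4)]) simp_all
  moreover have "\<bar>a z ?c\<bar> \<le> b q e"
    using clip_abs(1)[OF assms(1), of ?d] assms(3) by (intro abs_le) simp_all
  ultimately have "\<bar>a z ?d\<bar> \<le> b q e" by simp
  moreover have "a z ?d = real n * (a z x - (i / real n) * a z e)"
    using assms(2) by (simp add: bilinear_rsub[OF bilinear_a] bilinear_rmul[OF bilinear_a] algebra_simps)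
  ultimately have "real n * \<bar>a z x - (i / real n) * a z e\<bar> \<le> b q e" by (simp only: abs_mult abs_of_nat)
  then show ?thesis using assms(2) by (simp only: pos_le_divide_eq of_nat_0_less_iff mult.commute)
qed

text \<open>Superadditivity passes from the multiples of \<open>e\<close> to every \<open>x \<le> e\<close>, since on each piece of a
  tent partition \<open>x\<close> is nearly a multiple of \<open>e\<close>.\<close>

lemma superadditive_tent:
  assumes h: "dominated h g"
    and super: "\<And>c y. 0 \<le> c \<Longrightarrow> 0 \<le> y \<Longrightarrow> y \<le> e \<Longrightarrow>
      c * functional_modulus (\<lambda>z. a z e) y + functional_modulus h y
        \<le> functional_modulus (\<lambda>z. c * a z e + h z) y"
    and x: "0 \<le> x" "x \<le> e" and y: "0 \<le> y" "y \<le> e"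
  shows "functional_modulus (\<lambda>z. a z x) y + functional_modulus h y
    \<le> functional_modulus (\<lambda>z. a z x + h z) y"
proof -
  have e: "0 \<le> e" using x by order
  have domx: "dominated (\<lambda>z. a z x) (\<lambda>z. b z x)" and dome: "dominated (\<lambda>z. a z e) (\<lambda>z. b z e)"
    using x e by (simp_all add: dominated_right)
  have domxh: "dominated (\<lambda>z. a z x + h z) (\<lambda>z. b z x + g z)" by (rule dominated_add[OF domx h])
  let ?L = "functional_modulus (\<lambda>z. a z x) y + functional_modulus h y"
  let ?R = "functional_modulus (\<lambda>z. a z x + h z) y"
  \<comment> \<open>The factor 2: on each piece x is replaced by (i/n) e and back again, each time
    at the cost b (q i) e / n. By linearity of b in its first slot these costs add up to b y e /
    n.\<close>
  have step: "?L \<le> ?R + 2 * b y e / real n" if n: "0 < n" for n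
  proof -
    obtain q where q: "\<And>i. i \<le> n \<Longrightarrow> 0 \<le> q i" "(\<Sum>i\<le>n. q i) = y"
      "\<And>i. i \<le> n \<Longrightarrow> inf (q i) (pprt (\<bar>real n *\<^sub>R x - real i *\<^sub>R e\<bar> - e)) = 0"
      using tent_partition[OF x y, of n] by auto
    let ?d = "\<lambda>i. b (q i) e / real n"
    have piece: "functional_modulus (\<lambda>z. a z x) (q i) + functional_modulus h (q i)
        \<le> functional_modulus (\<lambda>z. a z x + h z) (q i) + 2 * ?d i" if i: "i \<le> n" for i
    proof -
      let ?c = "real i / real n"
      have c: "0 \<le> ?c" by simp
      have ap: "\<bar>a z x - ?c * a z e\<bar> \<le> ?d i" if "\<bar>z\<bar> \<le> q i" for z
        using tent_approx[OF e n that q(3)[OF i]] .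
      have qe: "q i \<le> e"
      proof -
        have "sum q {i} \<le> (\<Sum>i\<le>n. q i)" using q(1) i by (intro sum_mono2) auto
        with q(2) y show ?thesis by simp
      qed
      have "functional_modulus (\<lambda>z. a z x) (q i) \<le> functional_modulus (\<lambda>z. ?c * a z e) (q i) + ?d i"
        using ap q(1)[OF i]
        by (intro functional_modulus_perturb[OF dominated_cmult[OF dome c]]) (auto simp: abs_le_iff algebra_simps)
      also have "\<dots> = ?c * functional_modulus (\<lambda>z. a z e) (q i) + ?d i"
        using functional_modulus_cmult[OF dome q(1)[OF i] c] by simp
      finally have "functional_modulus (\<lambda>z. a z x) (q i) + functional_modulus h (q i)
          \<le> functional_modulus (\<lambda>z. ?c * a z e + h z) (q i) + ?d i"
        using super[OF c q(1)[OF i] qe] by linarith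
      also have "functional_modulus (\<lambda>z. ?c * a z e + h z) (q i)
          \<le> functional_modulus (\<lambda>z. a z x + h z) (q i) + ?d i"
        using ap q(1)[OF i] by (intro functional_modulus_perturb[OF domxh]) (auto simp: abs_le_iff algebra_simps)
      finally show ?thesis by simp
    qed
    have "?L = (\<Sum>i\<le>n. functional_modulus (\<lambda>z. a z x) (q i) + functional_modulus h (q i))"
      unfolding q(2)[symmetric] sum.distrib 
      using q(1) functional_modulus_sum[OF domx, of "{..n}" q] functional_modulus_sum[OF h, of "{..n}" q] by simp
    also have "\<dots> \<le> (\<Sum>i\<le>n. functional_modulus (\<lambda>z. a z x + h z) (q i) + 2 * ?d i)"
      using piece by (intro sum_mono) simp
    also have "\<dots> = ?R + 2 * ((\<Sum>i\<le>n. b (q i) e) / real n)"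
      unfolding sum.distrib sum_distrib_left[symmetric] sum_divide_distrib[symmetric]
      using functional_modulus_sum[OF domxh, of "{..n}" q] q by simp
    also have "(\<Sum>i\<le>n. b (q i) e) = b y e"
      unfolding q(2)[symmetric] using bilinear_b linear_sum[of "\<lambda>x. b x e" q "{..n}"] by (simp add: bilinear_def)
    finally show ?thesis by simp
  qed
  show ?thesis
  proof (rule LIMSEQ_le_const[OF _ exI[of _ 1]])
    have "(\<lambda>n. ?R + 2 * b y e / real n) \<longlonglongrightarrow> ?R + 0"
      by (intro tendsto_add tendsto_const lim_const_over_n)
    then show "(\<lambda>n. ?R + 2 * b y e / real n) \<longlonglongrightarrow> ?R" by simp
  qed (use step in auto)
qed

text \<open>The hard half is superadditivity. For two multiples of one e it is homogeneity of the
  modulus; a first use of \<open>superadditive_tent\<close> replaces one multiple by x', a second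
  one replaces the other by x. Both uses share e = x + x' + y, because tent partitions require all
  elements to lie below e.\<close>

lemma functional_modulus_add_right:
  assumes "0 \<le> x" "0 \<le> x'" "0 \<le> y"
  shows "functional_modulus (\<lambda>z. a z (x + x')) y
    = functional_modulus (\<lambda>z. a z x) y + functional_modulus (\<lambda>z. a z x') y"
proof (rule antisym)
  note d = dominated_right[OF assms(1)] dominated_right[OF assms(2)]
  have add: "a z (x + x') = a z x + a z x'" for z by (rule bilinear_radd[OF bilinear_a])
  show "functional_modulus (\<lambda>z. a z (x + x')) y
      \<le> functional_modulus (\<lambda>z. a z x) y + functional_modulus (\<lambda>z. a z x') y"
    using assms(3) functional_modulus_upper[OF d(1)] functional_modulus_upper[OF d(2)]
    by (intro functional_modulus_least) (auto simp: add intro: add_mono)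
  define e where "e = x + x' + y"
  have e: "0 \<le> e" "x \<le> e" "x' \<le> e" "y \<le> e"
    using assms by (simp_all add: e_def add_increasing add_increasing2)
  note de = dominated_right[OF e(1)]
  have 1: "functional_modulus (\<lambda>z. a z x') y + functional_modulus (\<lambda>z. c * a z e) y
      \<le> functional_modulus (\<lambda>z. a z x' + c * a z e) y" if "0 \<le> c" "0 \<le> y" "y \<le> e" for c and y :: 'a
  proof (rule superadditive_tent[OF dominated_cmult[OF de that(1)]])
    fix c' :: real and y :: 'a assume c': "0 \<le> c'" and y: "0 \<le> y"
    have "(\<lambda>z. c' * a z e + c * a z e) = (\<lambda>z. (c' + c) * a z e)" by (simp add: algebra_simps)
    then show "c' * functional_modulus (\<lambda>z. a z e) y + functional_modulus (\<lambda>z. c * a z e) y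
        \<le> functional_modulus (\<lambda>z. c' * a z e + c * a z e) y"
      using functional_modulus_cmult[OF de y add_nonneg_nonneg[OF c' that(1)]]
        functional_modulus_cmult[OF de y that(1)] by (simp add: distrib_right)
  qed (use assms e that in auto)
  have "functional_modulus (\<lambda>z. a z x) y + functional_modulus (\<lambda>z. a z x') y
      \<le> functional_modulus (\<lambda>z. a z x + a z x') y"
    using 1 functional_modulus_cmult[OF de]
    by (intro superadditive_tent[OF d(2), where e = e]) (use assms e in \<open>auto simp: add.commute\<close>)
  then show "functional_modulus (\<lambda>z. a z x) y + functional_modulus (\<lambda>z. a z x') y
      \<le> functional_modulus (\<lambda>z. a z (x + x')) y" by (simp add: add)
qed

end

section \<open>Symmetric multilinear forms\<close>

definition cone_lists :: "nat \<Rightarrow> 'a::banach_lattice list set" where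
  "cone_lists n = {xs. length xs = n \<and> (\<forall>x\<in>set xs. 0 \<le> x)}"

lemma cone_lists_Cons [simp]: "x # xs \<in> cone_lists (Suc n) \<longleftrightarrow> 0 \<le> x \<and> xs \<in> cone_lists n"
  by (auto simp: cone_lists_def)

lemma cone_lists_0 [simp]: "xs \<in> cone_lists 0 \<longleftrightarrow> xs = []"
  by (auto simp: cone_lists_def)

lemma Nil_notin_cone_lists [simp]: "[] \<notin> cone_lists (Suc n)"
  by (simp add: cone_lists_def)

lemma cone_lists_replicate [simp]: "0 \<le> x \<Longrightarrow> replicate n x \<in> cone_lists n"
  by (simp add: cone_lists_def)

lemma cone_lists_mset: "mset ys = mset xs \<Longrightarrow> ys \<in> cone_lists n \<longleftrightarrow> xs \<in> cone_lists n"
  using mset_eq_length[of ys xs] mset_eq_setD[of ys xs] by (simp add: cone_lists_def)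

lemma symmetric_multilinear_perm:
  "symmetric_multilinear m A \<Longrightarrow> length xs = m \<Longrightarrow> mset ys = mset xs \<Longrightarrow> A ys = A xs"
  unfolding symmetric_multilinear_def by blast

lemma symmetric_multilinear_linear:
  assumes "symmetric_multilinear m A" "Suc (length ys) = m"
  shows "linear (\<lambda>x. A (x # ys))"
proof -
  have "linear (\<lambda>x. A ((0 # ys)[0 := x]))"
    using assms unfolding symmetric_multilinear_def by (metis length_Cons zero_less_Suc)
  then show ?thesis by simp
qed

lemma symmetric_multilinearI:
  assumes lin: "\<And>ys. length ys = n \<Longrightarrow> linear (\<lambda>x. A (x # ys))"
    and sym: "\<And>xs ys. length xs = Suc n \<Longrightarrow> mset ys = mset xs \<Longrightarrow> A ys = A xs"
  shows "symmetric_multilinear (Suc n) A"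
  unfolding symmetric_multilinear_def
proof (intro conjI allI impI)
  fix xs :: "'a list" and i
  assume "length xs = Suc n \<and> i < Suc n"
  then have xs: "length xs = Suc n" and i: "i < length xs" by auto
  let ?ys = "take i xs @ drop (Suc i) xs"
  have eq: "A (xs[i := x]) = A (x # ?ys)" for x
    using xs i by (intro sym) (auto simp: upd_conv_take_nth_drop)
  show "linear (\<lambda>x. A (xs[i := x]))" unfolding eq using xs i by (intro lin) simp
qed (use sym in blast)

lemma symmetric_multilinear_comb:
  assumes "symmetric_multilinear m A" "symmetric_multilinear m B"
  shows "symmetric_multilinear m (\<lambda>xs. c * A xs + d * B xs)"
proof -
  have "linear (\<lambda>x. c * f x + d * g x)" if "linear f" "linear g" for f g :: "'a \<Rightarrow> real"
    using that by (intro linearI) (simp_all add: linear_add linear_scale algebra_simps)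
  moreover have "c * A ys + d * B ys = c * A xs + d * B xs" if "length xs = m" "mset ys = mset xs" for xs ys
    using symmetric_multilinear_perm[OF assms(1) that] symmetric_multilinear_perm[OF assms(2) that] by simp
  ultimately show ?thesis using assms unfolding symmetric_multilinear_def by blast
qed

section \<open>Expansion and polarization of a symmetric form\<close>

context
  fixes m :: nat and A :: "'a::real_vector list \<Rightarrow> real"
  assumes A: "symmetric_multilinear m A"
begin

lemma form_add: "Suc (length ys) = m \<Longrightarrow> A ((x + y) # ys) = A (x # ys) + A (y # ys)"
  using linear_add[OF symmetric_multilinear_linear[OF A]] .

lemma form_diff: "Suc (length ys) = m \<Longrightarrow> A ((x - y) # ys) = A (x # ys) - A (y # ys)"
  using linear_diff[OF symmetric_multilinear_linear[OF A]] .

lemma form_scaleR: "Suc (length ys) = m \<Longrightarrow> A ((c *\<^sub>R x) # ys) = c * A (x # ys)"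
  using linear_scale[OF symmetric_multilinear_linear[OF A]] by simp

lemma form_perm: "length xs = m \<Longrightarrow> mset ys = mset xs \<Longrightarrow> A ys = A xs"
  using symmetric_multilinear_perm[OF A] .

text \<open>The suffix ws collects the entries already treated: symmetry moves each processed entry
  behind the remaining block, so that the induction hypothesis applies. The later inductions over
  slots use the same device.\<close>

lemma form_scaleR_power:
  "n + length ws = m \<Longrightarrow> A (replicate n (c *\<^sub>R x) @ ws) = c ^ n * A (replicate n x @ ws)"
proof (induction n arbitrary: ws)
  case (Suc n)
  have "A (replicate (Suc n) (c *\<^sub>R x) @ ws) = c * A (x # replicate n (c *\<^sub>R x) @ ws)"
    using Suc.prems by (simp add: form_scaleR)
  also have "A (x # replicate n (c *\<^sub>R x) @ ws) = A (replicate n (c *\<^sub>R x) @ x # ws)"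
    using Suc.prems by (intro form_perm) auto
  also have "\<dots> = c ^ n * A (replicate n x @ x # ws)" using Suc by simp
  also have "A (replicate n x @ x # ws) = A (replicate (Suc n) x @ ws)"
    using Suc.prems by (intro form_perm) auto
  finally show ?case by simp
qed simp

lemma form_binomial:
  "n + length ws = m \<Longrightarrow> A (replicate n (x + y) @ ws)
    = (\<Sum>k\<le>n. real (n choose k) * A (replicate k y @ replicate (n - k) x @ ws))"
proof (induction n arbitrary: ws)
  case (Suc n)
  define F where "F k = A (replicate k y @ replicate (Suc n - k) x @ ws)" for k
  have "A (replicate (Suc n) (x + y) @ ws)
      = A (x # replicate n (x + y) @ ws) + A (y # replicate n (x + y) @ ws)"
    using Suc.prems by (simp add: form_add)
  also have "A (x # replicate n (x + y) @ ws) = A (replicate n (x + y) @ x # ws)"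
    using Suc.prems by (intro form_perm) auto
  also have "\<dots> = (\<Sum>k\<le>n. real (n choose k) * A (replicate k y @ replicate (n - k) x @ x # ws))"
    using Suc by simp
  also have "\<dots> = (\<Sum>k\<le>n. real (n choose k) * F k)"
  proof (intro sum.cong refl arg_cong2[where f = "(*)"])
    fix k assume "k \<in> {..n}"
    then show "A (replicate k y @ replicate (n - k) x @ x # ws) = F k"
      unfolding F_def using Suc.prems by (intro form_perm) (auto simp: Suc_diff_le)
  qed
  also have "A (y # replicate n (x + y) @ ws) = A (replicate n (x + y) @ y # ws)"
    using Suc.prems by (intro form_perm) auto
  also have "\<dots> = (\<Sum>k\<le>n. real (n choose k) * A (replicate k y @ replicate (n - k) x @ y # ws))"
    using Suc by simp
  also have "\<dots> = (\<Sum>k\<le>n. real (n choose k) * F (Suc k))"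
  proof (intro sum.cong refl arg_cong2[where f = "(*)"])
    fix k assume "k \<in> {..n}"
    then show "A (replicate k y @ replicate (n - k) x @ y # ws) = F (Suc k)"
      unfolding F_def using Suc.prems by (intro form_perm) auto
  qed
  also have "(\<Sum>k\<le>n. real (n choose k) * F k) + (\<Sum>k\<le>n. real (n choose k) * F (Suc k))
      = (\<Sum>k\<le>Suc n. real (Suc n choose k) * F k)"
  proof -
    have "(\<Sum>k\<le>n. real (n choose k) * F k) = (\<Sum>k\<le>Suc n. real (n choose k) * F k)" by simp
    also have "\<dots> = F 0 + (\<Sum>k\<le>n. real (n choose Suc k) * F (Suc k))"
      by (subst sum.atMost_Suc_shift) simp
    finally show ?thesis
      by (simp add: sum.atMost_Suc_shift sum.distrib algebra_simps del: sum.atMost_Suc)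
  qed
  finally show ?case by (simp only: F_def)
qed simp

text \<open>Mixed values of the form are read off as the coefficients of a real polynomial in t,
  which its values determine.\<close>

lemma form_coeffs:
  assumes "n + length ws = m" "\<And>t. A (replicate n (x + t *\<^sub>R y) @ ws) = (\<Sum>k\<le>n. d k * t ^ k)" "k \<le> n"
  shows "real (n choose k) * A (replicate k y @ replicate (n - k) x @ ws) = d k"
proof -
  define c where "c k = real (n choose k) * A (replicate k y @ replicate (n - k) x @ ws)" for k
  have "(\<Sum>k\<le>n. c k * t ^ k) = (\<Sum>k\<le>n. d k * t ^ k)" for t
  proof -
    have "A (replicate k (t *\<^sub>R y) @ replicate (n - k) x @ ws)
        = t ^ k * A (replicate k y @ replicate (n - k) x @ ws)" if "k \<le> n" for k
      using that assms(1) by (intro form_scaleR_power) auto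
    then have "(\<Sum>k\<le>n. c k * t ^ k) = A (replicate n (x + t *\<^sub>R y) @ ws)"
      unfolding form_binomial[OF assms(1)] c_def by (intro sum.cong) auto
    then show ?thesis using assms(2) by simp
  qed
  then have "\<forall>k\<le>n. c k = d k" using polyfun_eq_coeffs[where 'a = real] by blast
  with assms(3) show ?thesis by (simp add: c_def)
qed

lemma form_polarization:
  assumes S: "subspace S"
  shows "n + length ws = m \<Longrightarrow> (\<And>x. x \<in> S \<Longrightarrow> A (replicate n x @ ws) = 0) \<Longrightarrow>
    length xs = n \<Longrightarrow> set xs \<subseteq> S \<Longrightarrow> A (xs @ ws) = 0"
proof (induction xs arbitrary: n ws)
  case (Cons x xs)
  then obtain n' where n: "n = Suc n'" by (cases n) auto
  have "A (replicate n' z @ x # ws) = 0" if z: "z \<in> S" for z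
  proof -
    have "z + t *\<^sub>R x \<in> S" for t
      using z Cons.prems(4) S by (simp add: subspace_add subspace_scale)
    then have "A (replicate n (z + t *\<^sub>R x) @ ws) = (\<Sum>k\<le>n. 0 * t ^ k)" for t
      using Cons.prems(2) by simp
    from form_coeffs[OF Cons.prems(1) this, of 1] have "A (x # replicate n' z @ ws) = 0"
      by (simp add: n)
    also have "A (x # replicate n' z @ ws) = A (replicate n' z @ x # ws)"
      using Cons.prems(1) n by (intro form_perm) auto
    finally show ?thesis .
  qed
  then have "A (xs @ x # ws) = 0"
    using Cons.prems n by (intro Cons.IH[of n']) auto
  also have "A (xs @ x # ws) = A ((x # xs) @ ws)"
    using Cons.prems by (intro form_perm) auto
  finally show ?case .
next
  case Nil
  then show ?case using subspace_0[OF S] by fastforce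
qed

lemma form_eq_0I:
  assumes "\<And>x. A (replicate m x) = 0" "length xs = m"
  shows "A xs = 0"
  using form_polarization[OF subspace_UNIV, of m "[]" xs] assms by simp

end

lemma form_unique:
  assumes "symmetric_multilinear m A" "symmetric_multilinear m B"
    and "\<And>x. A (replicate m x) = B (replicate m x)" "length xs = m"
  shows "A xs = B xs"
  using form_eq_0I[OF symmetric_multilinear_comb[OF assms(1,2), of 1 "-1"] _ assms(4)] assms(3) by simp

text \<open>Every entry is a difference of two positive elements, so expanding entry by entry moves
  the whole list into the cone.\<close>

lemma form_eq_of_cone:
  assumes A: "symmetric_multilinear m A" and B: "symmetric_multilinear m B"
    and eq: "\<And>xs. xs \<in> cone_lists m \<Longrightarrow> A xs = B xs" and "length xs = m"
  shows "A xs = B xs"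
proof -
  have "A (xs @ ps) = B (xs @ ps)" if "ps \<in> cone_lists (length ps)" "length xs + length ps = m" for ps
    using that
  proof (induction xs arbitrary: ps)
    case (Cons x xs)
    have *: "A (z # xs @ ps) = B (z # xs @ ps)" if "0 \<le> z" for z
    proof -
      have "A (z # xs @ ps) = A (xs @ z # ps)" using Cons.prems by (intro form_perm[OF A]) auto
      moreover have "B (z # xs @ ps) = B (xs @ z # ps)" using Cons.prems by (intro form_perm[OF B]) auto
      ultimately show ?thesis using Cons that by simp
    qed
    have "A ((pprt x - pprt (- x)) # xs @ ps) = B ((pprt x - pprt (- x)) # xs @ ps)"
      using Cons.prems * form_diff[OF A] form_diff[OF B] by simp
    then show ?case by (simp flip: pprt_diff)
  qed (use eq in simp)
  from this[of "[]"] assms(4) show ?thesis by simp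
qed

section \<open>Positive and dominated forms\<close>

definition positive_form :: "nat \<Rightarrow> ('a::banach_lattice list \<Rightarrow> real) \<Rightarrow> bool" where
  "positive_form m B \<longleftrightarrow> symmetric_multilinear m B \<and> (\<forall>xs\<in>cone_lists m. 0 \<le> B xs)"

text \<open>\<open>B\<close> certifies regularity: A is the difference of the positive forms (B +
  A)/2 and (B - A)/2.\<close>

definition dominated_form :: "nat \<Rightarrow> ('a::banach_lattice list \<Rightarrow> real) \<Rightarrow> ('a list \<Rightarrow> real) \<Rightarrow> bool" where
  "dominated_form m A B \<longleftrightarrow> symmetric_multilinear m A \<and> symmetric_multilinear m B
     \<and> (\<forall>xs\<in>cone_lists m. \<bar>A xs\<bar> \<le> B xs)"

lemma dominated_form_positive: "dominated_form m A B \<Longrightarrow> positive_form m B"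
  unfolding dominated_form_def positive_form_def by (meson abs_ge_zero order_trans)

lemma dominated_form_functional:
  assumes "dominated_form (Suc n) A B" "ws \<in> cone_lists n"
  shows "dominated (\<lambda>z. A (z # ws)) (\<lambda>z. B (z # ws))"
  using assms unfolding dominated_form_def dominated_def
  by (auto intro!: symmetric_multilinear_linear simp: cone_lists_def)

lemma positive_form_mono:
  assumes B: "positive_form m B" and "list_all2 (\<le>) xs ys"
  shows "xs \<in> cone_lists (length xs) \<Longrightarrow> ws \<in> cone_lists (length ws) \<Longrightarrow>
    length xs + length ws = m \<Longrightarrow> B (xs @ ws) \<le> B (ys @ ws)"
  using assms(2)
proof (induction arbitrary: ws rule: list_all2_induct)
  case (Cons x xs y ys)
  have sB: "symmetric_multilinear m B" using B by (simp add: positive_form_def)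
  have len: "length ys = length xs" using Cons.hyps by (metis list_all2_lengthD)
  have y: "0 \<le> y" using Cons by (auto intro: order_trans)
  have "(y - x) # xs @ ws \<in> cone_lists m"
    using Cons by (auto simp: cone_lists_def)
  then have "0 \<le> B ((y - x) # xs @ ws)" using B by (simp add: positive_form_def)
  then have "B (x # xs @ ws) \<le> B (y # xs @ ws)"
    using form_diff[OF sB] Cons.prems by simp
  also have "\<dots> = B (xs @ y # ws)" using Cons.prems by (intro form_perm[OF sB]) auto
  also have "\<dots> \<le> B (ys @ y # ws)" using Cons y by simp
  also have "\<dots> = B (y # ys @ ws)" using Cons.prems len by (intro form_perm[OF sB]) auto
  finally show ?case by simp
qed simp

lemma positive_form_le_power:
  assumes "positive_form m B" "xs \<in> cone_lists m" "\<And>x. x \<in> set xs \<Longrightarrow> x \<le> e"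
  shows "B xs \<le> B (replicate m e)"
  using positive_form_mono[OF assms(1), of xs "replicate m e" "[]"] assms(2,3)
  by (simp add: cone_lists_def list_all2_conv_all_nth)

text \<open>Meant for f x = \<open>pprt (x - \<epsilon> *\<^sub>R e)\<close>: the entries are
  replaced one at a time, and shaving at most \<epsilon> e off one of them costs at most \<epsilon>
  B(e, ..., e).\<close>

lemma dominated_form_lipschitz:
  assumes AB: "dominated_form m A B" and eps: "0 \<le> \<epsilon>"
    and f: "\<And>x. 0 \<le> x \<Longrightarrow> 0 \<le> f x \<and> f x \<le> x \<and> x - f x \<le> \<epsilon> *\<^sub>R e"
  shows "length xs + length ws = m \<Longrightarrow> (\<And>x. x \<in> set (xs @ ws) \<Longrightarrow> 0 \<le> x \<and> x \<le> e) \<Longrightarrow>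
    \<bar>A (xs @ ws) - A (map f xs @ ws)\<bar> \<le> real (length xs) * (\<epsilon> * B (replicate m e))"
proof (induction xs arbitrary: ws)
  case (Cons x xs)
  have sA: "symmetric_multilinear m A" and sB: "symmetric_multilinear m B"
    and pB: "positive_form m B"
    using AB dominated_form_positive by (auto simp: dominated_form_def)
  obtain n where m: "m = Suc n" using Cons.prems(1) by (cases m) auto
  have x: "0 \<le> x" "x \<le> e" and fx: "0 \<le> f x" "f x \<le> x" "x - f x \<le> \<epsilon> *\<^sub>R e"
    using Cons.prems(2)[of x] f[of x] by auto
  have tl: "xs @ ws \<in> cone_lists n" using Cons.prems m by (auto simp: cone_lists_def)
  have "\<bar>A ((x - f x) # xs @ ws)\<bar> \<le> B ((x - f x) # xs @ ws)"
    using AB tl fx by (simp add: dominated_form_def m)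
  also have "\<dots> \<le> B ((\<epsilon> *\<^sub>R e) # replicate n e)"
  proof -
    have "(xs @ ws) ! i \<le> e" if "i < n" for i
      using Cons.prems(2)[of "(xs @ ws) ! i"] that tl nth_mem[of i "xs @ ws"] by (auto simp: cone_lists_def)
    then have "list_all2 (\<le>) (xs @ ws) (replicate n e)"
      using tl by (simp add: cone_lists_def list_all2_conv_all_nth)
    then have "list_all2 (\<le>) ((x - f x) # xs @ ws) ((\<epsilon> *\<^sub>R e) # replicate n e)"
      using fx by simp
    moreover have "length (xs @ ws) = n" using tl by (simp add: cone_lists_def)
    ultimately show ?thesis
      using positive_form_mono[OF pB, of "(x - f x) # xs @ ws" "(\<epsilon> *\<^sub>R e) # replicate n e" "[]"] tl fx m
      by simp
  qed
  also have "\<dots> = \<epsilon> * B (replicate m e)" using form_scaleR[OF sB] by (simp add: m)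
  finally have 1: "\<bar>A ((x - f x) # xs @ ws)\<bar> \<le> \<epsilon> * B (replicate m e)" .
  have "\<bar>A (xs @ f x # ws) - A (map f xs @ f x # ws)\<bar> \<le> real (length xs) * (\<epsilon> * B (replicate m e))"
    using Cons.prems fx x by (intro Cons.IH) (auto intro: order_trans)
  moreover have "A (xs @ f x # ws) = A (f x # xs @ ws)" "A (map f xs @ f x # ws) = A (f x # map f xs @ ws)"
    using Cons.prems by (intro form_perm[OF sA]; simp)+
  moreover have "A ((x - f x) # xs @ ws) = A (x # xs @ ws) - A (f x # xs @ ws)"
    using Cons.prems by (intro form_diff[OF sA]) simp
  ultimately show ?case using 1 by (simp add: distrib_right)
qed simp

lemma regular_poly_form:
  assumes "regular_poly m P"
  obtains A B where "dominated_form m A B" "\<And>x. P x = A (replicate m x)"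
proof -
  obtain P1 P2 A1 A2 where "P = (\<lambda>x. P1 x - P2 x)"
    "symmetric_multilinear m A1" "\<And>x. P1 x = A1 (replicate m x)" "\<And>xs. xs \<in> cone_lists m \<Longrightarrow> 0 \<le> A1 xs"
    "symmetric_multilinear m A2" "\<And>x. P2 x = A2 (replicate m x)" "\<And>xs. xs \<in> cone_lists m \<Longrightarrow> 0 \<le> A2 xs"
    using assms unfolding regular_poly_def positive_poly_def cone_lists_def by auto
  then show thesis
    using symmetric_multilinear_comb[of m A1 A2 1 "-1"] symmetric_multilinear_comb[of m A1 A2 1 1]
    by (intro that[of "\<lambda>xs. A1 xs - A2 xs" "\<lambda>xs. A1 xs + A2 xs"]) (auto simp: dominated_form_def abs_le_iff)
qed

section \<open>Orthogonal additivity and orthosymmetry\<close>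

lemma abs_scaleR_le: "\<bar>c *\<^sub>R x\<bar> \<le> \<bar>c\<bar> *\<^sub>R \<bar>x\<bar>" for x :: "'a::banach_lattice"
proof (cases "0 \<le> c")
  case True
  have "c *\<^sub>R x \<le> c *\<^sub>R \<bar>x\<bar>" "c *\<^sub>R (- x) \<le> c *\<^sub>R \<bar>x\<bar>"
    by (rule scaleR_left_mono[OF abs_ge_self True], rule scaleR_left_mono[OF abs_ge_minus_self True])
  then show ?thesis using True by (intro abs_leI) simp_all
next
  case False
  have "(- c) *\<^sub>R x \<le> (- c) *\<^sub>R \<bar>x\<bar>" "(- c) *\<^sub>R (- x) \<le> (- c) *\<^sub>R \<bar>x\<bar>"
    using False by (intro scaleR_left_mono abs_ge_self abs_ge_minus_self; simp)+
  then show ?thesis using False by (intro abs_leI) simp_all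
qed

lemma mem_disjoint_complement: "x \<in> disjoint_complement D \<longleftrightarrow> (\<forall>z\<in>D. inf \<bar>x\<bar> \<bar>z\<bar> = 0)"
  unfolding disjoint_complement_def disjoint_elts_def by (rule mem_Collect_eq)

lemma subspace_disjoint_complement: "subspace (disjoint_complement D)" for D :: "'a::banach_lattice set"
proof (rule subspaceI; unfold mem_disjoint_complement; intro ballI)
  fix z assume z: "z \<in> D"
  show "inf \<bar>0\<bar> \<bar>z\<bar> = 0" unfolding abs_zero by (rule inf_absorb1) simp
  fix x y assume "\<forall>z\<in>D. inf \<bar>x\<bar> \<bar>z\<bar> = 0" "\<forall>z\<in>D. inf \<bar>y\<bar> \<bar>z\<bar> = 0"
  then have "inf (\<bar>x\<bar> + \<bar>y\<bar>) \<bar>z\<bar> = 0"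
    using z by (blast intro: inf_zero_add)
  then show "inf \<bar>x + y\<bar> \<bar>z\<bar> = 0"
    by (rule inf_zero_mono[OF _ abs_ge_zero abs_triangle_ineq abs_ge_zero order_refl])
next
  fix c :: real and x z assume "\<forall>z\<in>D. inf \<bar>x\<bar> \<bar>z\<bar> = 0" "z \<in> D"
  then have "inf (\<bar>c\<bar> *\<^sub>R \<bar>x\<bar>) \<bar>z\<bar> = 0"
    by (blast intro: inf_zero_scaleR abs_ge_zero)
  then show "inf \<bar>c *\<^sub>R x\<bar> \<bar>z\<bar> = 0"
    by (rule inf_zero_mono[OF _ abs_ge_zero abs_scaleR_le abs_ge_zero order_refl])
qed

lemma disjoint_elts_commute: "disjoint_elts x y \<longleftrightarrow> disjoint_elts y x"
  by (simp add: disjoint_elts_def inf.commute)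

lemma inf_zero_sum_list:
  fixes y :: "'a::banach_lattice"
  assumes "\<And>x. x \<in> set xs \<Longrightarrow> inf x y = 0" "0 \<le> y"
  shows "inf (sum_list xs) y = 0"
  using assms
proof (induction xs)
  case (Cons x xs)
  then show ?case by (simp add: inf_zero_add)
qed (simp add: inf_absorb1)

lemma sum_list_upper:
  fixes x :: "'a::banach_lattice"
  shows "x \<in> set xs \<Longrightarrow> (\<And>x. x \<in> set xs \<Longrightarrow> 0 \<le> x) \<Longrightarrow> x \<le> sum_list xs"
  by (induction xs) (auto simp: sum_list_nonneg add_increasing add_increasing2)

lemma zero_of_eps_bound:
  fixes a c :: real
  assumes "\<And>\<epsilon>. 0 < \<epsilon> \<Longrightarrow> \<bar>a\<bar> \<le> \<epsilon> * c"
  shows "a = 0"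
proof (rule ccontr)
  assume "a \<noteq> 0"
  \<comment> \<open>This \<epsilon> makes \<epsilon> c at most |a| / 2; the + 1 avoids division by
    0.\<close>
  have "\<bar>a\<bar> \<le> \<bar>a\<bar> / (2 * (\<bar>c\<bar> + 1)) * c" using \<open>a \<noteq> 0\<close> by (intro assms) simp
  also have "\<dots> \<le> \<bar>a\<bar> / 2"
  proof -
    have "\<bar>a\<bar> * c \<le> \<bar>a\<bar> * (\<bar>c\<bar> + 1)" by (intro mult_left_mono) auto
    then show ?thesis by (simp add: field_simps)
  qed
  finally show False using \<open>a \<noteq> 0\<close> by simp
qed

text \<open>For x in X and y in Y the value of P at x + t y is P(x) + t^m P(y), so all mixed
  coefficients vanish. Polarization, first in Y and then in X, passes from powers to arbitrary
  entries; X and Y are taken as disjoint complements because these are subspaces.\<close>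

lemma orthogonally_additive_split:
  assumes A: "symmetric_multilinear m A"
    and oa: "\<And>x y. disjoint_elts x y \<Longrightarrow> A (replicate m (x + y)) = A (replicate m x) + A (replicate m y)"
    and dis: "\<And>x y. x \<in> set xs \<Longrightarrow> y \<in> set ys \<Longrightarrow> disjoint_elts x y"
    and ne: "xs \<noteq> []" "ys \<noteq> []" and len: "length xs + length ys = m"
  shows "A (xs @ ys) = 0"
proof -
  define Y where "Y = disjoint_complement (set xs)"
  define X where "X = disjoint_complement Y"
  have XY: "disjoint_elts x y" if "x \<in> X" "y \<in> Y" for x y
    using that by (simp add: X_def disjoint_complement_def)
  have xs: "set xs \<subseteq> X" and ys: "set ys \<subseteq> Y"
    unfolding X_def Y_def disjoint_complement_def using dis disjoint_elts_commute by blast+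
  have sub: "subspace X" "subspace Y" unfolding X_def Y_def by (rule subspace_disjoint_complement)+
  let ?k = "length ys"
  have k: "0 < ?k" "?k < m" "m - ?k = length xs" using ne len by (auto simp: neq_Nil_conv)
  have 1: "A (replicate ?k y @ replicate (length xs) x) = 0" if x: "x \<in> X" and y: "y \<in> Y" for x y
  proof -
    define d where "d k = (if k = 0 then A (replicate m x) else if k = m then A (replicate m y) else 0)" for k
    have "A (replicate m (x + t *\<^sub>R y) @ []) = (\<Sum>k\<le>m. d k * t ^ k)" for t
    proof -
      have "t *\<^sub>R y \<in> Y" using y sub(2) by (simp add: subspace_scale)
      then have "A (replicate m (x + t *\<^sub>R y)) = A (replicate m x) + A (replicate m (t *\<^sub>R y))"
        using x XY by (intro oa) auto
      also have "A (replicate m (t *\<^sub>R y)) = t ^ m * A (replicate m y)"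
        using form_scaleR_power[OF A, of m "[]"] by simp
      also have "A (replicate m x) + t ^ m * A (replicate m y) = (\<Sum>k\<in>{0, m}. d k * t ^ k)"
        using k by (simp add: d_def)
      also have "\<dots> = (\<Sum>k\<le>m. d k * t ^ k)"
        by (intro sum.mono_neutral_left) (auto simp: d_def)
      finally show ?thesis by simp
    qed
    from form_coeffs[OF A _ this, of ?k] k show ?thesis by (simp add: d_def)
  qed
  have 2: "A (replicate (length xs) x @ ys) = 0" if x: "x \<in> X" for x
  proof -
    have "A (ys @ replicate (length xs) x) = 0"
      by (rule form_polarization[OF A sub(2) _ 1[OF x] _ ys]) (use len in simp_all)
    also have "A (ys @ replicate (length xs) x) = A (replicate (length xs) x @ ys)"
      using len by (intro form_perm[OF A]) auto
    finally show ?thesis .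
  qed
  show ?thesis by (rule form_polarization[OF A sub(1) _ 2 _ xs]) (use len in simp_all)
qed

text \<open>The entries \<open>ws\<close> need not be disjoint from u or v, which goes beyond
  \<open>orthogonally_additive_split\<close>. For m = 1 the condition is vacuous.\<close>

definition orthosymmetric :: "nat \<Rightarrow> ('a::banach_lattice list \<Rightarrow> real) \<Rightarrow> bool" where
  "orthosymmetric m A \<longleftrightarrow> (\<forall>u v ws. inf u v = 0 \<longrightarrow> u # v # ws \<in> cone_lists m \<longrightarrow> A (u # v # ws) = 0)"

text \<open>Each \<open>w\<close> splits into a part disjoint from the truncations of \<open>xs\<close> and a part disjoint from
  \<open>ys\<close>, so it can be absorbed into one of the two groups.\<close>

lemma orthogonally_additive_split_absorb:
  assumes AB: "dominated_form m A B"
    and oa: "\<And>x y. disjoint_elts x y \<Longrightarrow> A (replicate m (x + y)) = A (replicate m x) + A (replicate m y)"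
  shows "xs @ ys @ ws \<in> cone_lists m \<Longrightarrow> xs \<noteq> [] \<Longrightarrow> ys \<noteq> [] \<Longrightarrow>
    (\<And>x y. x \<in> set xs \<Longrightarrow> y \<in> set ys \<Longrightarrow> inf x y = 0) \<Longrightarrow> A (xs @ ys @ ws) = 0"
proof (induction ws arbitrary: xs ys)
  case Nil
  have A: "symmetric_multilinear m A" using AB by (simp add: dominated_form_def)
  have "A (xs @ ys) = 0"
    using Nil by (intro orthogonally_additive_split[OF A oa]) (auto simp: cone_lists_def disjoint_elts_def)
  then show ?case by simp
next
  case (Cons w ws)
  have A: "symmetric_multilinear m A" using AB by (simp add: dominated_form_def)
  have pos: "\<And>x. x \<in> set xs \<Longrightarrow> 0 \<le> x" "\<And>y. y \<in> set ys \<Longrightarrow> 0 \<le> y" "0 \<le> w" "\<And>v. v \<in> set ws \<Longrightarrow> 0 \<le> v"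
    and len: "length xs + length ys + Suc (length ws) = m"
    using Cons.prems(1) by (auto simp: cone_lists_def)
  define U where "U = sum_list xs"
  define V where "V = sum_list ys"
  define e where "e = sum_list (xs @ ys @ w # ws)"
  have UV: "0 \<le> U" "0 \<le> V" "0 \<le> e" using pos by (auto simp: U_def V_def e_def intro!: sum_list_nonneg add_nonneg_nonneg)
  have le_e: "x \<le> e" if "x \<in> set (xs @ ys @ w # ws)" for x
    unfolding e_def using that pos by (intro sum_list_upper) auto
  have "inf U V = 0"
  proof -
    have "inf V x = 0" if x: "x \<in> set xs" for x
      unfolding V_def
    proof (rule inf_zero_sum_list)
      show "inf y x = 0" if "y \<in> set ys" for y
        using Cons.prems(4)[OF x that] by (subst inf.commute)
    qed (rule pos(1)[OF x])
    then show ?thesis unfolding U_def using UV by (intro inf_zero_sum_list) (simp_all only: inf.commute)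
  qed
  have "\<bar>A (xs @ ys @ w # ws)\<bar> \<le> \<epsilon> * (real (length xs) * B (replicate m e))" if eps: "0 < \<epsilon>" for \<epsilon>
  proof -
    define f where "f x = pprt (x - \<epsilon> *\<^sub>R e)" for x
    have ee: "0 \<le> \<epsilon> *\<^sub>R e" using UV(3) eps by (simp add: scaleR_nonneg_nonneg)
    have f: "0 \<le> f x \<and> f x \<le> x \<and> x - f x \<le> \<epsilon> *\<^sub>R e" if "0 \<le> x" for x
    proof -
      have "x - f x = inf x (\<epsilon> *\<^sub>R e)" unfolding f_def using eq_inf_add_pprt[of x "\<epsilon> *\<^sub>R e"] by (metis add_diff_cancel_right')
      then show ?thesis using that ee by (auto simp: f_def pprt_def)
    qed
    have lip: "\<bar>A (xs @ ys @ w # ws) - A (map f xs @ ys @ w # ws)\<bar>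
        \<le> real (length xs) * (\<epsilon> * B (replicate m e))"
      using pos len eps f le_e by (intro dominated_form_lipschitz[OF AB]) auto
    \<comment> \<open>c lives where U < \<epsilon> e, away from every \<open>f x\<close>, so
      \<open>inf w c\<close> can join ys. Since w \<le> e, the excess of w over c is at most U /
      \<epsilon>, which is disjoint from V, so it can join the truncated xs. Truncating xs by f is
      what makes room for this cut.\<close>
    define c where "c = (1/\<epsilon>) *\<^sub>R pprt (\<epsilon> *\<^sub>R e - U)"
    have c0: "0 \<le> c" using eps by (simp add: c_def scaleR_nonneg_nonneg)
    define w1 where "w1 = inf w c"
    define w2 where "w2 = pprt (w - c)"
    have w: "w = w1 + w2" unfolding w1_def w2_def by (rule eq_inf_add_pprt)
    have w0: "0 \<le> w1" "0 \<le> w2" using pos c0 by (auto simp: w1_def w2_def)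
    have fw1: "inf (f x) w1 = 0" if x: "x \<in> set xs" for x
    proof -
      have "x \<le> U" unfolding U_def using x pos by (intro sum_list_upper)
      then have fU: "f x \<le> pprt (U - \<epsilon> *\<^sub>R e)" unfolding f_def by (intro pprt_mono) simp
      have "inf (pprt (\<epsilon> *\<^sub>R e - U)) (pprt (U - \<epsilon> *\<^sub>R e)) = 0"
        using inf_pprt_neg[of "\<epsilon> *\<^sub>R e - U"] by simp
      then have "inf c (pprt (U - \<epsilon> *\<^sub>R e)) = 0"
        unfolding c_def using eps by (intro inf_zero_scaleR) simp_all
      then have "inf w1 (f x) = 0"
        by (rule inf_zero_mono) (use f[OF pos(1)[OF x]] fU w0 in \<open>simp_all add: w1_def\<close>)
      then show ?thesis by (subst inf.commute)
    qed
    have w2y: "inf w2 y = 0" if y: "y \<in> set ys" for y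
    proof -
      have "\<epsilon> *\<^sub>R e - U \<le> pprt (\<epsilon> *\<^sub>R e - U)" by (simp add: pprt_def)
      then have "(1/\<epsilon>) *\<^sub>R (\<epsilon> *\<^sub>R e - U) \<le> c" unfolding c_def using eps by (intro scaleR_left_mono) simp_all
      then have "e - (1/\<epsilon>) *\<^sub>R U \<le> c" using eps by (simp add: scaleR_diff_right)
      then have "e - c \<le> (1/\<epsilon>) *\<^sub>R U" by (simp add: algebra_simps)
      moreover have "w - c \<le> e - c" using le_e by simp
      ultimately have "w - c \<le> (1/\<epsilon>) *\<^sub>R U" by (rule order_trans[rotated])
      then have "w2 \<le> (1/\<epsilon>) *\<^sub>R U"
        unfolding w2_def pprt_def using UV eps by (simp add: scaleR_nonneg_nonneg)
      moreover have "inf ((1/\<epsilon>) *\<^sub>R U) V = 0" using \<open>inf U V = 0\<close> eps by (intro inf_zero_scaleR) auto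
      moreover have "y \<le> V" unfolding V_def using y pos by (intro sum_list_upper)
      ultimately show ?thesis using w0(2) pos(2)[OF y] by (blast intro: inf_zero_mono)
    qed
    have fxy: "inf (f x) y = 0" if "x \<in> set xs" "y \<in> set ys" for x y
      using f[OF pos(1)[OF that(1)]] pos(2)[OF that(2)] by (intro inf_zero_mono[OF Cons.prems(4)[OF that]]) auto
    have fpos: "0 \<le> f x" if "x \<in> set xs" for x using f pos that by blast
    have "A (map f xs @ (w1 # ys) @ ws) = 0"
      using Cons.prems(2) pos len w0 fw1 fxy fpos by (intro Cons.IH) (auto simp: cone_lists_def)
    also have "A (map f xs @ (w1 # ys) @ ws) = A (w1 # map f xs @ ys @ ws)"
      using len by (intro form_perm[OF A]) auto
    finally have 1: "A (w1 # map f xs @ ys @ ws) = 0" .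
    have "A ((w2 # map f xs) @ ys @ ws) = 0"
      using Cons.prems(3) pos len w0 w2y fxy fpos by (intro Cons.IH) (auto simp: cone_lists_def)
    then have "A ((w1 + w2) # map f xs @ ys @ ws) = 0"
      using 1 form_add[OF A] len by simp
    also have "A ((w1 + w2) # map f xs @ ys @ ws) = A (map f xs @ ys @ w # ws)"
      unfolding w[symmetric] using len by (intro form_perm[OF A]) auto
    finally show ?thesis using lip by (simp add: mult.commute mult.left_commute)
  qed
  then show ?case by (rule zero_of_eps_bound)
qed

lemma orthogonally_additive_orthosymmetric:
  assumes "dominated_form m A B"
    and "\<And>x y. disjoint_elts x y \<Longrightarrow> A (replicate m (x + y)) = A (replicate m x) + A (replicate m y)"
  shows "orthosymmetric m A"
  unfolding orthosymmetric_def
  using orthogonally_additive_split_absorb[OF assms, of "[_]" "[_]"] by simp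

section \<open>The modulus of an orthosymmetric form\<close>

text \<open>The usual extension of an additive function from the cone to the whole space, by the
  difference of its values at the positive and the negative part, carried out in one slot after the
  other.\<close>

primrec cone_extension :: "'a::banach_lattice list \<Rightarrow> ('a list \<Rightarrow> real) \<Rightarrow> real" where
  "cone_extension [] F = F []"
| "cone_extension (x # xs) F = cone_extension xs (\<lambda>ys. F (pprt x # ys) - F (pprt (- x) # ys))"

lemma cone_extension_cong:
  "(\<And>ys. ys \<in> cone_lists (length xs) \<Longrightarrow> F ys = G ys) \<Longrightarrow> cone_extension xs F = cone_extension xs G"
proof (induction xs arbitrary: F G)
  case (Cons x xs)
  show ?case unfolding cone_extension.simps
    by (rule Cons.IH) (use Cons.prems in simp)
qed simp

lemma cone_extension_comb:
  "cone_extension xs (\<lambda>ys. c * F ys + d * G ys) = c * cone_extension xs F + d * cone_extension xs G"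
proof (induction xs arbitrary: F G)
  case (Cons x xs)
  have "(\<lambda>ys. (c * F (pprt x # ys) + d * G (pprt x # ys)) - (c * F (pprt (- x) # ys) + d * G (pprt (- x) # ys)))
      = (\<lambda>ys. c * (F (pprt x # ys) - F (pprt (- x) # ys)) + d * (G (pprt x # ys) - G (pprt (- x) # ys)))"
    by (simp add: algebra_simps)
  then show ?case by (simp only: cone_extension.simps Cons.IH)
qed simp

text \<open>For x \<ge> 0 the subtracted term is a value of F with a zero entry, hence the
  assumption on such lists.\<close>

lemma cone_extension_cone:
  "xs \<in> cone_lists n \<Longrightarrow> (\<And>ys. ys \<in> cone_lists n \<Longrightarrow> 0 \<in> set ys \<Longrightarrow> F ys = 0) \<Longrightarrow> cone_extension xs F = F xs"
proof (induction xs arbitrary: n F)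
  case (Cons x xs)
  then obtain k where n: "n = Suc k" by (auto simp: cone_lists_def)
  have x: "0 \<le> x" "xs \<in> cone_lists k" using Cons.prems(1) by (simp_all add: n)
  have "cone_extension (x # xs) F = cone_extension xs (\<lambda>ys. F (x # ys) - F (0 # ys))"
    using x(1) by simp
  also have "\<dots> = cone_extension xs (\<lambda>ys. F (x # ys))"
    using Cons.prems(2) x by (intro cone_extension_cong) (simp add: n cone_lists_def)
  also have "\<dots> = F (x # xs)"
    using x Cons.prems(2) by (intro Cons.IH[of k]) (simp_all add: n)
  finally show ?case .
qed simp

text \<open>With equal heads the induction hypothesis permutes the tails. With different heads both
  are pulled to the front, where only symmetry of F in the first two slots is needed.\<close>

lemma cone_extension_perm:
  fixes xs ys :: "'a::banach_lattice list"
  assumes "length xs = n" "mset ys = mset xs"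
    and "\<And>us vs. us \<in> cone_lists n \<Longrightarrow> mset vs = mset us \<Longrightarrow> F vs = F us"
  shows "cone_extension ys F = cone_extension xs F"
  using assms
proof (induction n arbitrary: xs ys F)
  case (Suc n)
  have step: "cone_extension (x # us) F = cone_extension (x # vs) F"
    if len: "length vs = n" and eq: "mset us = mset vs" for x :: 'a and us vs
    unfolding cone_extension.simps
  proof (rule Suc.IH[OF len eq])
    fix ps qs :: "'a list" assume ps: "ps \<in> cone_lists n" "mset qs = mset ps"
    have "F (z # qs) = F (z # ps)" if "0 \<le> z" for z
      using Suc.prems(3)[of "z # ps" "z # qs"] ps that by simp
    then show "F (pprt x # qs) - F (pprt (- x) # qs) = F (pprt x # ps) - F (pprt (- x) # ps)" by simp
  qed
  obtain x xs' where xs: "xs = x # xs'" "length xs' = n" using Suc.prems(1) by (cases xs) auto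
  obtain y ys' where ys: "ys = y # ys'" "length ys' = n"
    using Suc.prems(1) mset_eq_length[OF Suc.prems(2)] by (cases ys) auto
  show ?case
  proof (cases "x = y")
    case True
    then show ?thesis using step[OF xs(2), of ys' x] Suc.prems(2) by (simp add: xs ys)
  next
    case False
    have "y \<in> set xs'" using mset_eq_setD[OF Suc.prems(2)] False by (auto simp: xs ys)
    then obtain k where k: "n = Suc k" using xs by (cases n) auto
    define zs where "zs = remove1 y xs'"
    have xs': "mset xs' = mset (y # zs)" using \<open>y \<in> set xs'\<close> by (simp add: zs_def)
    have ys': "mset ys' = mset (x # zs)" using Suc.prems(2) xs' by (auto simp: xs ys add_eq_conv_ex)
    have lz: "length zs = k" using xs' mset_eq_length xs k by fastforce
    have "cone_extension xs F = cone_extension (x # y # zs) F"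
      using step[of "y # zs" xs'] xs' lz by (simp add: xs k)
    also have "\<dots> = cone_extension (y # x # zs) F"
    proof -
      have F: "F (u # v # ws) = F (v # u # ws)" if "0 \<le> u" "0 \<le> v" "ws \<in> cone_lists k" for u v ws
        using Suc.prems(3)[of "v # u # ws" "u # v # ws"] that by (simp add: k)
      show ?thesis
        unfolding cone_extension.simps by (rule cone_extension_cong) (use F in \<open>simp add: lz\<close>)
    qed
    also have "\<dots> = cone_extension ys F"
      using step[of "x # zs" ys'] ys' lz by (simp add: ys k)
    finally show ?thesis by simp
  qed
qed simp

lemma linear_cone_extension_slot:
  fixes \<phi> :: "'a::banach_lattice \<Rightarrow> real"
  assumes add: "\<And>x y. 0 \<le> x \<Longrightarrow> 0 \<le> y \<Longrightarrow> \<phi> (x + y) = \<phi> x + \<phi> y"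
    and scale: "\<And>c x. 0 < c \<Longrightarrow> 0 \<le> x \<Longrightarrow> \<phi> (c *\<^sub>R x) = c * \<phi> x"
  shows "linear (\<lambda>x. \<phi> (pprt x) - \<phi> (pprt (- x)))"
proof (rule linearI)
  fix x y :: 'a
  \<comment> \<open>Written without differences, so that \<phi> is only applied to sums of positive
    elements.\<close>
  have "pprt (x + y) + (pprt (- x) + pprt (- y)) = pprt (- (x + y)) + (pprt x + pprt y)"
  proof -
    have p: "pprt z = z + pprt (- z)" for z :: 'a
      using pprt_diff[of z] by (metis diff_add_cancel)
    have "pprt (- (x + y)) + (pprt x + pprt y)
        = pprt (- (x + y)) + ((x + pprt (- x)) + (y + pprt (- y)))"
      by (simp only: p[symmetric])
    also have "\<dots> = (x + y + pprt (- (x + y))) + (pprt (- x) + pprt (- y))"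
      by (simp only: ac_simps)
    finally show ?thesis by (simp only: p[symmetric])
  qed
  then have "\<phi> (pprt (x + y) + (pprt (- x) + pprt (- y))) = \<phi> (pprt (- (x + y)) + (pprt x + pprt y))" by simp
  then show "\<phi> (pprt (x + y)) - \<phi> (pprt (- (x + y)))
      = (\<phi> (pprt x) - \<phi> (pprt (- x))) + (\<phi> (pprt y) - \<phi> (pprt (- y)))"
    by (simp add: add add_nonneg_nonneg del: minus_add_distrib)
next
  fix c :: real and x :: 'a
  have pos: "\<phi> (pprt (c *\<^sub>R x)) - \<phi> (pprt (- (c *\<^sub>R x))) = c * (\<phi> (pprt x) - \<phi> (pprt (- x)))"
    if "0 < c" for c and x :: 'a
    using that pprt_scaleR[OF that, of x] pprt_scaleR[OF that, of "- x"] by (simp add: scale right_diff_distrib)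
  consider "0 < c" | "c = 0" | "0 < - c" by linarith
  then show "\<phi> (pprt (c *\<^sub>R x)) - \<phi> (pprt (- (c *\<^sub>R x))) = c *\<^sub>R (\<phi> (pprt x) - \<phi> (pprt (- x)))"
  proof cases
    case 3
    from pos[OF this, of "- x"] show ?thesis by (simp add: algebra_simps)
  qed (use pos in simp_all)
qed

lemma cone_extension_symmetric_multilinear:
  assumes add: "\<And>x y ws. 0 \<le> x \<Longrightarrow> 0 \<le> y \<Longrightarrow> ws \<in> cone_lists n \<Longrightarrow> F ((x + y) # ws) = F (x # ws) + F (y # ws)"
    and scale: "\<And>c x ws. 0 < c \<Longrightarrow> 0 \<le> x \<Longrightarrow> ws \<in> cone_lists n \<Longrightarrow> F ((c *\<^sub>R x) # ws) = c * F (x # ws)"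
    and sym: "\<And>us vs. us \<in> cone_lists (Suc n) \<Longrightarrow> mset vs = mset us \<Longrightarrow> F vs = F us"
  shows "symmetric_multilinear (Suc n) (\<lambda>xs. cone_extension xs F)"
proof (rule symmetric_multilinearI)
  fix ys :: "'a list" assume len: "length ys = n"
  define G where "G x = (\<lambda>zs. F (pprt x # zs) - F (pprt (- x) # zs))" for x
  have lin: "linear (\<lambda>x. G x zs)" if "zs \<in> cone_lists n" for zs
    unfolding G_def using that by (intro linear_cone_extension_slot add scale)
  have "linear (\<lambda>x. cone_extension ys (G x))"
  proof (rule linearI)
    fix x y
    have "cone_extension ys (G (x + y)) = cone_extension ys (\<lambda>zs. 1 * G x zs + 1 * G y zs)"
      by (rule cone_extension_cong) (use linear_add[OF lin] len in simp)
    then show "cone_extension ys (G (x + y)) = cone_extension ys (G x) + cone_extension ys (G y)"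
      unfolding cone_extension_comb by simp
  next
    fix c x
    have "cone_extension ys (G (c *\<^sub>R x)) = cone_extension ys (\<lambda>zs. c * G x zs + 0 * G x zs)"
      by (rule cone_extension_cong) (use linear_scale[OF lin] len in simp)
    then show "cone_extension ys (G (c *\<^sub>R x)) = c *\<^sub>R cone_extension ys (G x)"
      unfolding cone_extension_comb by simp
  qed
  then show "linear (\<lambda>x. cone_extension (x # ys) F)" by (simp add: G_def)
next
  fix xs ys :: "'a list" assume "length xs = Suc n" "mset ys = mset xs"
  then show "cone_extension ys F = cone_extension xs F" using sym by (rule cone_extension_perm)
qed

section \<open>The one-slot modulus of an orthosymmetric form\<close>

text \<open>For an orthosymmetric form the modulus of \<open>A\<close> on the cone is the modulus of the functional in a
  single slot; symmetry and additivity in the other slots are then automatic.\<close>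

definition modulus_cone :: "('a::banach_lattice list \<Rightarrow> real) \<Rightarrow> 'a list \<Rightarrow> real" where
  "modulus_cone A ys = functional_modulus (\<lambda>z. A (z # tl ys)) (hd ys)"

lemma modulus_cone_Cons [simp]: "modulus_cone A (y # ys) = functional_modulus (\<lambda>z. A (z # ys)) y"
  by (simp add: modulus_cone_def)

definition modulus_form :: "('a::banach_lattice list \<Rightarrow> real) \<Rightarrow> 'a list \<Rightarrow> real" where
  "modulus_form A xs = cone_extension xs (modulus_cone A)"

locale orthosymmetric_form =
  fixes n :: nat and A B :: "'a::banach_lattice list \<Rightarrow> real"
  assumes dom: "dominated_form (Suc n) A B" and os: "orthosymmetric (Suc n) A"
begin

lemma A: "symmetric_multilinear (Suc n) A" and B: "symmetric_multilinear (Suc n) B"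
  using dom by (simp_all add: dominated_form_def)

lemmas slot = dominated_form_functional[OF dom]

text \<open>Let H(v) be the modulus in the slot of x with v in the other one. For |z| \<le> y,
  symmetry bounds A(z, x) by H at the positive part plus H at the negative part of z. As H is
  additive on the cone by \<open>functional_modulus_add_right\<close>, this is H(|z|) \<le> H(y).
  Exchanging x and y gives equality.\<close>

lemma modulus_cone_swap_le:
  assumes "0 \<le> x" "0 \<le> y" "x # ws \<in> cone_lists n"
  shows "modulus_cone A (y # x # ws) \<le> modulus_cone A (x # y # ws)"
proof -
  obtain k where n: "n = Suc k" and ws: "ws \<in> cone_lists k" using assms(3) by (cases n) auto
  have len: "length ws = k" using ws by (simp add: cone_lists_def)
  interpret orthosymmetric_bilinear "\<lambda>z x. A (z # x # ws)" "\<lambda>z x. B (z # x # ws)"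
  proof
    have bil: "bilinear (\<lambda>z x. C (z # x # ws))" if C: "symmetric_multilinear (Suc n) C" for C
      unfolding bilinear_def
    proof (intro conjI allI)
      fix z
      have "(\<lambda>x. C (z # x # ws)) = (\<lambda>x. C (x # z # ws))"
        using len by (intro ext form_perm[OF C]) (auto simp: n)
      then show "linear (\<lambda>x. C (z # x # ws))"
        using symmetric_multilinear_linear[OF C, of "z # ws"] len by (simp add: n)
      show "linear (\<lambda>x. C (x # z # ws))"
        using len by (intro symmetric_multilinear_linear[OF C]) (simp add: n)
    qed
    show "bilinear (\<lambda>z x. A (z # x # ws))" "bilinear (\<lambda>z x. B (z # x # ws))"
      using bil[OF A] bil[OF B] .
    show "\<bar>A (z # x # ws)\<bar> \<le> B (z # x # ws)" if "0 \<le> z" "0 \<le> x" for z x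
      using dom ws that by (simp add: dominated_form_def n)
    show "A (z # x # ws) = 0" if "inf z x = 0" for z x
    proof -
      have "0 \<le> z" "0 \<le> x" using that by (metis inf.cobounded1 inf.cobounded2)+
      then show ?thesis using os that ws by (simp add: orthosymmetric_def n)
    qed
  qed
  have y: "y # ws \<in> cone_lists n" using assms(2) ws by (simp add: n)
  show ?thesis unfolding modulus_cone_Cons
  proof (rule functional_modulus_least[OF assms(2)])
    fix z assume z: "\<bar>z\<bar> \<le> y"
    let ?H = "\<lambda>v. functional_modulus (\<lambda>z. A (z # v # ws)) x"
    have le: "\<bar>A (x # v # ws)\<bar> \<le> ?H v" if "0 \<le> v" for v
      using that assms(1) ws by (intro functional_modulus_ge_abs[OF slot]) (simp_all add: n)
    have swap: "A (v # x # ws) = A (x # v # ws)" for v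
      using len by (intro form_perm[OF A]) (auto simp: n)
    have "A (z # x # ws) = A (x # (pprt z - pprt (- z)) # ws)"
      unfolding swap by (simp flip: pprt_diff)
    also have "\<dots> = A (x # pprt z # ws) - A (x # pprt (- z) # ws)"
      by (rule bilinear_rsub[OF bilinear_a])
    also have "\<dots> \<le> ?H (pprt z) + ?H (pprt (- z))"
      using le[of "pprt z"] le[of "pprt (- z)"] by simp
    also have "\<dots> = ?H \<bar>z\<bar>"
      unfolding abs_eq_pprt_add using assms(1) by (subst functional_modulus_add_right) simp_all
    also have "\<dots> \<le> ?H \<bar>z\<bar> + ?H (y - \<bar>z\<bar>)"
      using z assms(1) ws by (simp add: functional_modulus_nonneg[OF slot] n)
    also have "\<dots> = ?H (\<bar>z\<bar> + (y - \<bar>z\<bar>))"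
      using z assms(1) by (subst functional_modulus_add_right) simp_all
    finally show "A (z # x # ws) \<le> ?H y" by simp
  qed
qed

lemma modulus_cone_perm:
  assumes us: "us \<in> cone_lists (Suc n)" and eq: "mset vs = mset us"
  shows "modulus_cone A vs = modulus_cone A us"
proof -
  have tail: "modulus_cone A (x # ps) = modulus_cone A (x # qs)"
    if "length qs = n" "mset ps = mset qs" for x ps qs
  proof -
    have "A (z # ps) = A (z # qs)" for z using that by (intro form_perm[OF A]) auto
    then show ?thesis by simp
  qed
  have vs: "vs \<in> cone_lists (Suc n)" using us cone_lists_mset[OF eq] by simp
  obtain x xs where xs: "us = x # xs" "0 \<le> x" "xs \<in> cone_lists n" using us by (cases us) (auto simp: cone_lists_def)
  obtain y ys where ys: "vs = y # ys" "0 \<le> y" "ys \<in> cone_lists n" using vs by (cases vs) (auto simp: cone_lists_def)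
  have len: "length xs = n" "length ys = n" using xs ys by (simp_all add: cone_lists_def)
  show ?thesis
  proof (cases "x = y")
    case True
    then show ?thesis using tail[OF len(1), of ys x] eq by (simp only: xs ys) simp
  next
    case False
    have "y \<in> set xs" using mset_eq_setD[OF eq] False by (auto simp: xs ys)
    define zs where "zs = remove1 y xs"
    have xs': "mset xs = mset (y # zs)" using \<open>y \<in> set xs\<close> by (simp add: zs_def)
    have ys': "mset ys = mset (x # zs)" using eq xs' by (auto simp: xs ys add_eq_conv_ex)
    have cone: "y # zs \<in> cone_lists n" "x # zs \<in> cone_lists n"
      using cone_lists_mset[OF xs'] cone_lists_mset[OF ys'] xs ys by simp_all
    have "modulus_cone A us = modulus_cone A (x # y # zs)"
      unfolding xs(1) using cone xs' by (intro tail) (simp_all add: cone_lists_def)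
    also have "\<dots> = modulus_cone A (y # x # zs)"
      using modulus_cone_swap_le[OF _ _ cone(1)] modulus_cone_swap_le[OF _ _ cone(2)] xs(2) ys(2)
      by (intro antisym) blast+
    also have "\<dots> = modulus_cone A vs"
      unfolding ys(1) using ys ys' by (intro tail[symmetric, OF _ ys'[symmetric]] tail) (simp_all add: len)
    finally show ?thesis by simp
  qed
qed

lemma symmetric_multilinear_modulus_form: "symmetric_multilinear (Suc n) (modulus_form A)"
  unfolding modulus_form_def
proof (rule cone_extension_symmetric_multilinear)
  show "modulus_cone A ((x + y) # ws) = modulus_cone A (x # ws) + modulus_cone A (y # ws)"
    if "0 \<le> x" "0 \<le> y" "ws \<in> cone_lists n" for x y ws
    using functional_modulus_add[OF slot] that by simp
  show "modulus_cone A ((c *\<^sub>R x) # ws) = c * modulus_cone A (x # ws)"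
    if "0 < c" "0 \<le> x" "ws \<in> cone_lists n" for c x ws
    using functional_modulus_scaleR[OF slot] that by simp
qed (rule modulus_cone_perm)

lemma modulus_form_Cons:
  assumes "0 \<le> y" "ws \<in> cone_lists n"
  shows "modulus_form A (y # ws) = functional_modulus (\<lambda>z. A (z # ws)) y"
proof -
  have "modulus_form A (y # ws) = modulus_cone A (y # ws)"
    unfolding modulus_form_def
  proof (rule cone_extension_cone)
    show "y # ws \<in> cone_lists (Suc n)" using assms by simp
    fix ys :: "'a list" assume ys: "ys \<in> cone_lists (Suc n)" "0 \<in> set ys"
    \<comment> \<open>By symmetry the zero entry may be moved to the slot in which the modulus is
      taken.\<close>
    then have m: "mset (0 # remove1 0 ys) = mset ys" by simp
    have "remove1 0 ys \<in> cone_lists n" using ys cone_lists_mset[OF m, of "Suc n"] by simp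
    then have "modulus_cone A (0 # remove1 0 ys) = 0" by (simp add: functional_modulus_0[OF slot])
    with modulus_cone_perm[OF ys(1) m] show "modulus_cone A ys = 0" by simp
  qed
  then show ?thesis by simp
qed

lemma modulus_form_ge: "xs \<in> cone_lists (Suc n) \<Longrightarrow> \<bar>A xs\<bar> \<le> modulus_form A xs"
  by (cases xs) (auto simp: modulus_form_Cons intro: functional_modulus_ge_abs[OF slot])

lemma modulus_form_le:
  assumes "dominated_form (Suc n) A C" "xs \<in> cone_lists (Suc n)"
  shows "modulus_form A xs \<le> C xs"
  using assms(2) by (cases xs) (auto simp: modulus_form_Cons intro: functional_modulus_le[OF dominated_form_functional[OF assms(1)]])

lemma dominated_form_modulus: "dominated_form (Suc n) A (modulus_form A)"
  using A symmetric_multilinear_modulus_form modulus_form_ge by (simp add: dominated_form_def)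

text \<open>Everything in [-u, u] is again disjoint from v, so the supremum defining the modulus
  runs over zeros.\<close>

lemma orthosymmetric_modulus_form: "orthosymmetric (Suc n) (modulus_form A)"
  unfolding orthosymmetric_def
proof (intro allI impI)
  fix u v :: 'a and ws assume uv: "inf u v = 0" and c: "u # v # ws \<in> cone_lists (Suc n)"
  then have u: "0 \<le> u" and vws: "v # ws \<in> cone_lists n" by simp_all
  have v: "0 \<le> v" using vws by (simp add: cone_lists_def)
  have z0: "A (z # v # ws) = 0" if "\<bar>z\<bar> \<le> u" for z
  proof -
    have *: "A (p # v # ws) = 0" if "0 \<le> p" "p \<le> \<bar>z\<bar>" for p
    proof -
      have "p \<le> u" using that(2) \<open>\<bar>z\<bar> \<le> u\<close> by order
      then have "inf p v = 0" using that(1) v by (intro inf_zero_mono[OF uv]) simp_all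
      then show ?thesis using os that(1) vws by (simp add: orthosymmetric_def)
    qed
    have "A (pprt z # v # ws) = 0" "A (pprt (- z) # v # ws) = 0"
      by (intro *; simp add: abs_eq_pprt_add)+
    moreover have "A ((pprt z - pprt (- z)) # v # ws) = A (pprt z # v # ws) - A (pprt (- z) # v # ws)"
      using vws by (intro form_diff[OF A]) (simp add: cone_lists_def)
    ultimately show ?thesis by (simp flip: pprt_diff)
  qed
  have "functional_modulus (\<lambda>z. A (z # v # ws)) u \<le> 0"
    using u z0 by (intro functional_modulus_least) simp_all
  moreover have "0 \<le> functional_modulus (\<lambda>z. A (z # v # ws)) u"
    using u vws by (intro functional_modulus_nonneg[OF slot])
  ultimately show "modulus_form A (u # v # ws) = 0"
    using u vws by (simp add: modulus_form_Cons)
qed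

end

section \<open>Lattice operations on orthogonally additive polynomials\<close>

definition diagonal :: "nat \<Rightarrow> ('a list \<Rightarrow> real) \<Rightarrow> 'a \<Rightarrow> real" where
  "diagonal m A x = A (replicate m x)"

text \<open>By uniqueness of the symmetric form, the one hidden in \<open>positive_poly\<close> is
  A. Order relations between polynomials thus become pointwise inequalities between forms on the
  cone.\<close>

lemma positive_poly_diagonal_iff:
  assumes A: "symmetric_multilinear m A"
  shows "positive_poly m (diagonal m A) \<longleftrightarrow> positive_form m A"
proof
  assume "positive_poly m (diagonal m A)"
  then obtain C where C: "symmetric_multilinear m C" "\<And>x. A (replicate m x) = C (replicate m x)"
      "\<And>xs. xs \<in> cone_lists m \<Longrightarrow> 0 \<le> C xs"
    unfolding positive_poly_def diagonal_def cone_lists_def by auto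
  have "A xs = C xs" if "xs \<in> cone_lists m" for xs
    using that by (intro form_unique[OF A C(1,2)]) (simp add: cone_lists_def)
  with A C(3) show "positive_form m A" by (simp add: positive_form_def)
qed (auto simp: positive_poly_def positive_form_def cone_lists_def diagonal_def)

lemma poly_le_diagonal_iff:
  assumes "symmetric_multilinear m A" "symmetric_multilinear m C"
  shows "poly_le m (diagonal m A) (diagonal m C) \<longleftrightarrow> (\<forall>xs\<in>cone_lists m. A xs \<le> C xs)"
proof -
  have s: "symmetric_multilinear m (\<lambda>xs. C xs - A xs)"
    using symmetric_multilinear_comb[OF assms(2,1), of 1 "-1"] by simp
  then have "positive_form m (\<lambda>xs. C xs - A xs) \<longleftrightarrow> (\<forall>xs\<in>cone_lists m. A xs \<le> C xs)"
    by (simp add: positive_form_def)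
  then show ?thesis
    using positive_poly_diagonal_iff[OF s] by (simp add: poly_le_def diagonal_def[abs_def])
qed

lemma regular_poly_diagonal:
  assumes "dominated_form m A B"
  shows "regular_poly m (diagonal m A)"
proof -
  have A: "symmetric_multilinear m A" and B: "symmetric_multilinear m B"
    using assms by (simp_all add: dominated_form_def)
  have s: "symmetric_multilinear m (\<lambda>xs. (B xs + c * A xs) / 2)" for c
    using symmetric_multilinear_comb[OF B A, of "1/2" "c/2"] by (simp add: add_divide_distrib)
  have "positive_form m (\<lambda>xs. (B xs + c * A xs) / 2)" if "c \<in> {1, -1}" for c
    using assms s that by (auto simp: positive_form_def dominated_form_def abs_le_iff)
  then have p: "positive_poly m (diagonal m (\<lambda>xs. (B xs + c * A xs) / 2))" if "c \<in> {1, -1}" for c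
    using positive_poly_diagonal_iff[OF s] that by blast
  have "diagonal m A = (\<lambda>x. diagonal m (\<lambda>xs. (B xs + 1 * A xs) / 2) x - diagonal m (\<lambda>xs. (B xs + (-1) * A xs) / 2) x)"
    by (simp add: diagonal_def fun_eq_iff field_simps)
  then show ?thesis using p unfolding regular_poly_def by blast
qed

lemma regular_polyE:
  assumes "regular_poly m P"
  obtains A B where "dominated_form m A B" "P = diagonal m A"
  using regular_poly_form[OF assms] by (metis diagonal_def ext)

lemma poly_le_antisym:
  assumes "regular_poly m P" "regular_poly m Q" "poly_le m P Q" "poly_le m Q P"
  shows "P = Q"
proof -
  obtain A B where P: "dominated_form m A B" "P = diagonal m A" using assms(1) by (rule regular_polyE)
  obtain C D where Q: "dominated_form m C D" "Q = diagonal m C" using assms(2) by (rule regular_polyE)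
  have A: "symmetric_multilinear m A" and C: "symmetric_multilinear m C"
    using P Q by (simp_all add: dominated_form_def)
  have "A xs = C xs" if "xs \<in> cone_lists m" for xs
    using that assms(3,4) poly_le_diagonal_iff[OF A C] poly_le_diagonal_iff[OF C A]
    unfolding P(2) Q(2) by (meson antisym)
  then have "A xs = C xs" if "length xs = m" for xs using that by (rule form_eq_of_cone[OF A C])
  then show ?thesis unfolding P(2) Q(2) by (simp add: diagonal_def fun_eq_iff)
qed

text \<open>Suprema are not constructed for arbitrary regular polynomials: those that occur are
  exhibited, and antisymmetry identifies them with the described ones.\<close>

lemma poly_sup_eqI:
  assumes "regular_poly m R" "poly_le m P R" "poly_le m Q R"
    and "\<And>S. regular_poly m S \<Longrightarrow> poly_le m P S \<Longrightarrow> poly_le m Q S \<Longrightarrow> poly_le m R S"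
  shows "poly_sup m P Q = R"
  unfolding poly_sup_def using assms poly_le_antisym by (intro the_equality) blast+

lemma poly_inf_eqI:
  assumes "regular_poly m R" "poly_le m R P" "poly_le m R Q"
    and "\<And>S. regular_poly m S \<Longrightarrow> poly_le m S P \<Longrightarrow> poly_le m S Q \<Longrightarrow> poly_le m S R"
  shows "poly_inf m P Q = R"
  unfolding poly_inf_def using assms poly_le_antisym by (intro the_equality) blast+

context orthosymmetric_form
begin

text \<open>The form of a polynomial above both P and -P dominates A, so minimality is
  \<open>modulus_form_le\<close>.\<close>

lemma poly_abs_diagonal: "poly_abs (Suc n) (diagonal (Suc n) A) = diagonal (Suc n) (modulus_form A)"
proof -
  have neg: "symmetric_multilinear (Suc n) (\<lambda>xs. - A xs)"
    using symmetric_multilinear_comb[OF A A, of "-1" 0] by simp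
  have negd: "(\<lambda>x. - diagonal (Suc n) A x) = diagonal (Suc n) (\<lambda>xs. - A xs)"
    by (simp add: diagonal_def fun_eq_iff)
  note N = symmetric_multilinear_modulus_form
  have pN: "dominated_form (Suc n) (modulus_form A) (modulus_form A)"
    using dominated_form_positive[OF dominated_form_modulus] by (simp add: dominated_form_def positive_form_def)
  show ?thesis unfolding poly_abs_def negd
  proof (rule poly_sup_eqI)
    show "regular_poly (Suc n) (diagonal (Suc n) (modulus_form A))"
      using pN by (rule regular_poly_diagonal)
    show "poly_le (Suc n) (diagonal (Suc n) A) (diagonal (Suc n) (modulus_form A))"
      "poly_le (Suc n) (diagonal (Suc n) (\<lambda>xs. - A xs)) (diagonal (Suc n) (modulus_form A))"
      unfolding poly_le_diagonal_iff[OF A N] poly_le_diagonal_iff[OF neg N]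
      using modulus_form_ge by (force simp: abs_le_iff)+
    fix S :: "'a \<Rightarrow> real" assume "regular_poly (Suc n) S"
    then obtain C D where S: "dominated_form (Suc n) C D" "S = diagonal (Suc n) C" by (rule regular_polyE)
    then have C: "symmetric_multilinear (Suc n) C" by (simp add: dominated_form_def)
    assume "poly_le (Suc n) (diagonal (Suc n) A) S" "poly_le (Suc n) (diagonal (Suc n) (\<lambda>xs. - A xs)) S"
    then have "dominated_form (Suc n) A C"
      unfolding S(2) poly_le_diagonal_iff[OF A C] poly_le_diagonal_iff[OF neg C]
      using A C by (simp add: dominated_form_def abs_le_iff)
    then show "poly_le (Suc n) (diagonal (Suc n) (modulus_form A)) S"
      unfolding S(2) poly_le_diagonal_iff[OF N C] using modulus_form_le by blast
  qed
qed

end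

section \<open>The infimum of two positive orthosymmetric forms\<close>

text \<open>The vector lattice identity inf(M, N) = (M + N - |M - N|)/2; the modulus is available
  because M - N is again orthosymmetric.\<close>

definition inf_form :: "('a::banach_lattice list \<Rightarrow> real) \<Rightarrow> ('a list \<Rightarrow> real) \<Rightarrow> 'a list \<Rightarrow> real" where
  "inf_form M N xs = (M xs + N xs - modulus_form (\<lambda>xs. M xs - N xs) xs) / 2"

context
  fixes n :: nat and M N :: "'a::banach_lattice list \<Rightarrow> real"
  assumes M: "positive_form (Suc n) M" "orthosymmetric (Suc n) M"
    and N: "positive_form (Suc n) N" "orthosymmetric (Suc n) N"
begin

lemma orthosymmetric_form_diff: "orthosymmetric_form n (\<lambda>xs. M xs - N xs) (\<lambda>xs. M xs + N xs)"
proof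
  show "orthosymmetric (Suc n) (\<lambda>xs. M xs - N xs)"
    using M(2) N(2) by (simp add: orthosymmetric_def)
  show "dominated_form (Suc n) (\<lambda>xs. M xs - N xs) (\<lambda>xs. M xs + N xs)"
    using M(1) N(1) symmetric_multilinear_comb[of "Suc n" M N 1 "-1"] symmetric_multilinear_comb[of "Suc n" M N 1 1]
    by (simp add: dominated_form_def positive_form_def abs_le_iff)
qed

interpretation D: orthosymmetric_form n "\<lambda>xs. M xs - N xs" "\<lambda>xs. M xs + N xs"
  by (rule orthosymmetric_form_diff)

lemma inf_form_le:
  assumes "xs \<in> cone_lists (Suc n)"
  shows "inf_form M N xs \<le> M xs" "inf_form M N xs \<le> N xs"
  using D.modulus_form_ge[OF assms] by (auto simp: inf_form_def abs_le_iff)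

lemma positive_form_inf: "positive_form (Suc n) (inf_form M N)"
proof -
  have "symmetric_multilinear (Suc n) (\<lambda>xs. (1/2) * (M xs + N xs) + (-1/2) * modulus_form (\<lambda>xs. M xs - N xs) xs)"
    by (rule symmetric_multilinear_comb[OF D.B D.symmetric_multilinear_modulus_form])
  moreover have "(\<lambda>xs. (1/2) * (M xs + N xs) + (-1/2) * modulus_form (\<lambda>xs. M xs - N xs) xs) = inf_form M N"
    by (simp add: inf_form_def fun_eq_iff field_simps)
  ultimately have "symmetric_multilinear (Suc n) (inf_form M N)" by simp
  then show ?thesis
    using D.modulus_form_le[OF D.dom] by (simp add: positive_form_def inf_form_def)
qed

lemma poly_inf_diagonal:
  "poly_inf (Suc n) (diagonal (Suc n) M) (diagonal (Suc n) N) = diagonal (Suc n) (inf_form M N)"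
proof (rule poly_inf_eqI)
  have sM: "symmetric_multilinear (Suc n) M" and sN: "symmetric_multilinear (Suc n) N"
    and sK: "symmetric_multilinear (Suc n) (inf_form M N)"
    using M N positive_form_inf by (simp_all add: positive_form_def)
  have "dominated_form (Suc n) (inf_form M N) (inf_form M N)"
    using positive_form_inf by (simp add: dominated_form_def positive_form_def)
  then show "regular_poly (Suc n) (diagonal (Suc n) (inf_form M N))" by (rule regular_poly_diagonal)
  show "poly_le (Suc n) (diagonal (Suc n) (inf_form M N)) (diagonal (Suc n) M)"
    "poly_le (Suc n) (diagonal (Suc n) (inf_form M N)) (diagonal (Suc n) N)"
    unfolding poly_le_diagonal_iff[OF sK sM] poly_le_diagonal_iff[OF sK sN] using inf_form_le by blast+
  fix S :: "'a \<Rightarrow> real" assume "regular_poly (Suc n) S"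
  then obtain C D where S: "dominated_form (Suc n) C D" "S = diagonal (Suc n) C" by (rule regular_polyE)
  then have C: "symmetric_multilinear (Suc n) C" by (simp add: dominated_form_def)
  assume "poly_le (Suc n) S (diagonal (Suc n) M)" "poly_le (Suc n) S (diagonal (Suc n) N)"
  then have le: "C xs \<le> M xs" "C xs \<le> N xs" if "xs \<in> cone_lists (Suc n)" for xs
    unfolding S(2) poly_le_diagonal_iff[OF C sM] poly_le_diagonal_iff[OF C sN] using that by blast+
  \<comment> \<open>On the cone, C \<le> M and C \<le> N together say that |M - N| \<le> M + N - 2
    C.\<close>
  have "symmetric_multilinear (Suc n) (\<lambda>xs. 1 * (M xs + N xs) + (-2) * C xs)"
    by (rule symmetric_multilinear_comb[OF D.B C])
  then have "dominated_form (Suc n) (\<lambda>xs. M xs - N xs) (\<lambda>xs. 1 * (M xs + N xs) + (-2) * C xs)"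
    using D.A le by (fastforce simp: dominated_form_def abs_le_iff)
  from D.modulus_form_le[OF this] have "C xs \<le> inf_form M N xs" if "xs \<in> cone_lists (Suc n)" for xs
    using that by (fastforce simp: inf_form_def)
  then show "poly_le (Suc n) S (diagonal (Suc n) (inf_form M N))"
    unfolding S(2) poly_le_diagonal_iff[OF C sK] by blast
qed

end

section \<open>Null elements of a positive form\<close>

lemma positive_form_mono_slot:
  assumes "positive_form (Suc n) B" "x \<le> y" "ws \<in> cone_lists n"
  shows "B (x # ws) \<le> B (y # ws)"
proof -
  have "0 \<le> B ((y - x) # ws)" using assms by (simp add: positive_form_def)
  then show ?thesis
    using assms form_diff[of "Suc n" B ws y x] by (simp add: positive_form_def cone_lists_def)
qed

lemma positive_form_slot:
  assumes "positive_form (Suc n) B" "ws \<in> cone_lists n"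
  shows "linear (\<lambda>z. B (z # ws))" and "0 \<le> z \<Longrightarrow> 0 \<le> B (z # ws)"
  using assms by (auto simp: positive_form_def cone_lists_def intro: symmetric_multilinear_linear)

text \<open>Absolute continuity of \<open>N(\<cdot>, x, \<dots>, x)\<close> with respect to \<open>N(\<cdot>, \<dots>, \<cdot>)\<close>: away from the part of
  \<open>y\<close> below \<open>\<epsilon> (x + y)\<close>, the element \<open>x\<close> is bounded by \<open>y / \<epsilon>\<close>.\<close>

lemma positive_form_null_slot:
  assumes N: "positive_form (Suc n) N" and os: "orthosymmetric (Suc n) N"
    and x: "0 \<le> x" and y: "0 \<le> y" and null: "N (replicate (Suc n) y) = 0"
  shows "N (y # replicate n x) = 0"
proof -
  have sN: "symmetric_multilinear (Suc n) N" using N by (simp add: positive_form_def)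
  define e where "e = x + y"
  have e: "0 \<le> e" "x \<le> e" "y \<le> e" using x y by (simp_all add: e_def)
  have "\<bar>N (y # replicate n x)\<bar> \<le> \<epsilon> * N (replicate (Suc n) e)" if eps: "0 < \<epsilon>" for \<epsilon>
  proof -
    define u where "u = pprt (y - \<epsilon> *\<^sub>R e)"
    define c where "c = 1 / \<epsilon>"
    have c: "0 < c" "c * \<epsilon> = 1" using eps by (simp_all add: c_def)
    have ee: "0 \<le> \<epsilon> *\<^sub>R e" using e eps by (simp add: scaleR_nonneg_nonneg)
    have u: "0 \<le> u" "u \<le> y" using y ee by (simp_all add: u_def pprt_def)
    have disj: "inf (pprt (x - c *\<^sub>R y)) u = 0"
    proof -
      have "x - c *\<^sub>R y \<le> c *\<^sub>R (\<epsilon> *\<^sub>R e - y)"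
        using e(2) c by (simp add: scaleR_diff_right)
      then have "pprt (x - c *\<^sub>R y) \<le> c *\<^sub>R pprt (\<epsilon> *\<^sub>R e - y)"
        using pprt_mono pprt_scaleR[OF c(1)] by metis
      moreover have "inf (c *\<^sub>R pprt (\<epsilon> *\<^sub>R e - y)) u = 0"
        unfolding u_def using inf_pprt_neg[of "\<epsilon> *\<^sub>R e - y"] c by (intro inf_zero_scaleR) simp_all
      ultimately show ?thesis using u(1) by (blast intro: inf_zero_mono zero_le_pprt)
    qed
    \<comment> \<open>Starting from entries y only, one y at a time is exchanged for x: the part of
      x below c y is controlled by the list with one more y, and the excess of x over c y is
      disjoint from u.\<close>
    have "N (u # replicate k x @ replicate j y) = 0" if "k + j = n" for k j
      using that
    proof (induction k arbitrary: j)
      case 0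
      have "N (u # replicate n y) \<le> N (y # replicate n y)"
        using u y by (intro positive_form_mono_slot[OF N]) simp_all
      moreover have "0 \<le> N (u # replicate n y)" using u y by (intro positive_form_slot(2)[OF N]) simp_all
      ultimately show ?case using null 0 by simp
    next
      case (Suc k)
      let ?R = "replicate k x @ replicate j y"
      have R: "u # ?R \<in> cone_lists n" using u(1) x y Suc.prems by (auto simp: cone_lists_def)
      have lR: "length ?R = k + j" by simp
      have "N (u # replicate (Suc k) x @ replicate j y) = N (x # u # ?R)"
        using Suc.prems by (intro form_perm[OF sN]) auto
      also have "\<dots> = N ((inf x (c *\<^sub>R y) + pprt (x - c *\<^sub>R y)) # u # ?R)"
        by (simp flip: eq_inf_add_pprt)
      also have "\<dots> = N (inf x (c *\<^sub>R y) # u # ?R) + N (pprt (x - c *\<^sub>R y) # u # ?R)"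
        using Suc.prems by (intro form_add[OF sN]) simp
      also have "N (pprt (x - c *\<^sub>R y) # u # ?R) = 0"
        using os disj R by (simp add: orthosymmetric_def)
      also have "N (inf x (c *\<^sub>R y) # u # ?R) = 0"
      proof -
        have "N (inf x (c *\<^sub>R y) # u # ?R) \<le> N ((c *\<^sub>R y) # u # ?R)"
          using R by (intro positive_form_mono_slot[OF N]) simp_all
        also have "\<dots> = c * N (y # u # ?R)" using Suc.prems by (intro form_scaleR[OF sN]) simp
        also have "N (y # u # ?R) = N (u # replicate k x @ replicate (Suc j) y)"
          using Suc.prems by (intro form_perm[OF sN]) auto
        also have "\<dots> = 0" using Suc.prems by (intro Suc.IH) simp
        finally have "N (inf x (c *\<^sub>R y) # u # ?R) \<le> 0" by simp
        moreover have "0 \<le> N (inf x (c *\<^sub>R y) # u # ?R)"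
          using R x y c by (intro positive_form_slot(2)[OF N]) (simp_all add: scaleR_nonneg_nonneg)
        ultimately show ?thesis by simp
      qed
      finally show ?case by simp
    qed
    from this[of n 0] have ux: "N (u # replicate n x) = 0" by simp
    have "N (y # replicate n x) = N ((inf y (\<epsilon> *\<^sub>R e) + u) # replicate n x)"
      unfolding u_def by (simp flip: eq_inf_add_pprt)
    also have "\<dots> = N (inf y (\<epsilon> *\<^sub>R e) # replicate n x)"
      using ux form_add[OF sN] by simp
    also have "\<dots> \<le> N ((\<epsilon> *\<^sub>R e) # replicate n x)"
      using x by (intro positive_form_mono_slot[OF N]) simp_all
    also have "\<dots> = \<epsilon> * N (e # replicate n x)" by (intro form_scaleR[OF sN]) simp
    also have "\<dots> \<le> \<epsilon> * N (replicate (Suc n) e)"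
      using x e eps by (intro mult_left_mono positive_form_le_power[OF N]) auto
    finally show ?thesis using positive_form_slot(2)[OF N, of "replicate n x" y] x y by simp
  qed
  then show ?thesis by (rule zero_of_eps_bound)
qed

section \<open>Order continuity\<close>

text \<open>A downward directed set with infimum 0, to be read as a net indexed by itself. Testing z
  \<ge> 0 is enough: the elements are positive, so a lower bound z may be replaced by
  \<open>pprt z\<close>.\<close>

definition null_directed :: "'a::banach_lattice set \<Rightarrow> bool" where
  "null_directed D \<longleftrightarrow> D \<noteq> {} \<and> (\<forall>a\<in>D. 0 \<le> a) \<and> (\<forall>a\<in>D. \<forall>b\<in>D. \<exists>c\<in>D. c \<le> a \<and> c \<le> b)
     \<and> (\<forall>z\<ge>0. (\<forall>a\<in>D. z \<le> a) \<longrightarrow> z = 0)"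

lemma null_directed_net:
  fixes D :: "'a::banach_lattice set"
  assumes "null_directed D"
  shows "directed_set D (\<lambda>a b. b \<le> a)" and "0 < c \<Longrightarrow> decreases_to_0 D (\<lambda>a b. b \<le> a) (\<lambda>a. c *\<^sub>R a)"
proof -
  show "directed_set D (\<lambda>a b. b \<le> a)"
    using assms unfolding null_directed_def directed_set_def by (blast intro: order_trans)
  assume c: "0 < c"
  show "decreases_to_0 D (\<lambda>a b. b \<le> a) (\<lambda>a. c *\<^sub>R a)"
    unfolding decreases_to_0_def
  proof (intro conjI ballI allI impI)
    show "0 \<le> c *\<^sub>R a" if "a \<in> D" for a
      using assms that c by (simp add: null_directed_def scaleR_nonneg_nonneg)
    show "c *\<^sub>R b \<le> c *\<^sub>R a" if "b \<le> a" for a b :: 'a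
      using that c by (simp add: scaleR_left_mono)
    fix z assume z: "\<forall>a\<in>D. z \<le> c *\<^sub>R a"
    have "(1/c) *\<^sub>R pprt z \<le> a" if "a \<in> D" for a
    proof -
      have "pprt z \<le> c *\<^sub>R a"
        using z that assms c by (simp add: pprt_def null_directed_def scaleR_nonneg_nonneg)
      then have "(1/c) *\<^sub>R pprt z \<le> (1/c) *\<^sub>R (c *\<^sub>R a)" using c by (intro scaleR_left_mono) simp_all
      then show ?thesis using c by simp
    qed
    moreover have "0 \<le> (1/c) *\<^sub>R pprt z" using c by (simp add: scaleR_nonneg_nonneg)
    ultimately have "(1/c) *\<^sub>R pprt z = 0" using assms unfolding null_directed_def by blast
    then show "z \<le> 0" using c by (simp add: le_zero_iff_zero_pprt)
  qed
qed

context orthosymmetric_form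
begin

text \<open>The binomial expansion of P(x + t u) isolates the coefficient m A(u, x, ..., x) of t.
  Since t \<le> 1, each later term is at most t^2 times a binomial coefficient times B(e, ..., e),
  and the binomial coefficients sum to 2^m.\<close>

lemma taylor_first_order:
  assumes x: "0 \<le> x" "x \<le> e" and u: "0 \<le> u" "u \<le> e" and t: "0 \<le> t" "t \<le> 1"
  shows "real (Suc n) * t * \<bar>A (u # replicate n x)\<bar>
    \<le> \<bar>diagonal (Suc n) A (x + t *\<^sub>R u) - diagonal (Suc n) A x\<bar>
      + t\<^sup>2 * (2 ^ Suc n * B (replicate (Suc n) e))"
proof -
  let ?m = "Suc n" and ?b = "B (replicate (Suc n) e)"
  note pB = dominated_form_positive[OF dom]
  define c where "c k = real (?m choose k) * A (replicate k u @ replicate (?m - k) x)" for k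
  have "0 \<le> e" using x by order
  then have b0: "0 \<le> ?b" using pB cone_lists_replicate[of e ?m] unfolding positive_form_def by blast
  have c_le: "\<bar>c k\<bar> \<le> real (?m choose k) * ?b" if "k \<le> ?m" for k
  proof -
    have xs: "replicate k u @ replicate (?m - k) x \<in> cone_lists ?m"
      using that x u by (auto simp: cone_lists_def)
    have "\<bar>A (replicate k u @ replicate (?m - k) x)\<bar> \<le> B (replicate k u @ replicate (?m - k) x)"
      using dom xs by (simp add: dominated_form_def)
    also have "\<dots> \<le> ?b" using x u by (intro positive_form_le_power[OF pB xs]) auto
    finally show ?thesis unfolding c_def by (simp add: abs_mult mult_left_mono)
  qed
  have "diagonal ?m A (x + t *\<^sub>R u) = (\<Sum>k\<le>?m. t ^ k * c k)"
  proof -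
    have "A (replicate k (t *\<^sub>R u) @ replicate (?m - k) x) = t ^ k * A (replicate k u @ replicate (?m - k) x)"
      if "k \<le> ?m" for k using that by (intro form_scaleR_power[OF A]) simp
    then show ?thesis
      using form_binomial[OF A, of ?m "[]" x "t *\<^sub>R u"] unfolding diagonal_def c_def
      by (simp add: mult.left_commute)
  qed
  also have "\<dots> = (\<Sum>k\<in>{..?m} - {0, 1}. t ^ k * c k) + (\<Sum>k\<in>{0, 1}. t ^ k * c k)"
    by (intro sum.subset_diff) auto
  also have "(\<Sum>k\<in>{0, 1}. t ^ k * c k) = diagonal ?m A x + t * (real ?m * A (u # replicate n x))"
    by (simp add: c_def diagonal_def)
  finally have eq: "diagonal ?m A (x + t *\<^sub>R u) - diagonal ?m A x
      = (\<Sum>k\<in>{..?m} - {0, 1}. t ^ k * c k) + t * (real ?m * A (u # replicate n x))" by simp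
  have "\<bar>\<Sum>k\<in>{..?m} - {0, 1}. t ^ k * c k\<bar> \<le> (\<Sum>k\<in>{..?m} - {0, 1}. \<bar>t ^ k * c k\<bar>)"
    by (rule sum_abs)
  also have "\<dots> \<le> (\<Sum>k\<in>{..?m} - {0, 1}. t\<^sup>2 * (real (?m choose k) * ?b))"
  proof (rule sum_mono)
    fix k assume k: "k \<in> {..?m} - {0, 1}"
    then have "t ^ k \<le> t\<^sup>2" using t by (intro power_decreasing) auto
    then show "\<bar>t ^ k * c k\<bar> \<le> t\<^sup>2 * (real (?m choose k) * ?b)"
      using c_le[of k] k t unfolding abs_mult by (intro mult_mono) auto
  qed
  also have "\<dots> \<le> (\<Sum>k\<le>?m. t\<^sup>2 * (real (?m choose k) * ?b))"
    using b0 by (intro sum_mono2) auto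
  also have "\<dots> = t\<^sup>2 * ((\<Sum>k\<le>?m. real (?m choose k)) * ?b)"
    by (simp only: sum_distrib_left sum_distrib_right)
  also have "(\<Sum>k\<le>?m. real (?m choose k)) = 2 ^ ?m"
    using choose_row_sum[of ?m] by (metis of_nat_sum of_nat_power of_nat_numeral)
  finally have "\<bar>\<Sum>k\<in>{..?m} - {0, 1}. t ^ k * c k\<bar> \<le> t\<^sup>2 * (2 ^ ?m * ?b)" .
  moreover have "real ?m * t * \<bar>A (u # replicate n x)\<bar> = \<bar>t * (real ?m * A (u # replicate n x))\<bar>"
    using t by (simp add: abs_mult)
  ultimately show ?thesis using eq by linarith
qed

text \<open>First t is fixed so that the quadratic remainder divided by t is at most \<epsilon>/2,
  then d is taken so far in D that the increment of P is below t \<epsilon>/2. Truncation by w keeps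
  all increments below one e, so the remainder bound does not depend on d.\<close>

lemma order_continuous_slot:
  assumes oc: "order_continuous (diagonal (Suc n) A)" and D: "null_directed D"
    and x: "0 \<le> x" and w: "0 \<le> w" and eps: "0 < \<epsilon>"
  shows "\<exists>d1\<in>D. \<forall>d\<in>D. d \<le> d1 \<longrightarrow> \<bar>A (inf w d # replicate n x)\<bar> < \<epsilon>"
proof -
  let ?P = "diagonal (Suc n) A"
  define e where "e = x + w"
  have e: "0 \<le> e" "x \<le> e" "w \<le> e" using x w by (simp_all add: e_def)
  define C where "C = 2 ^ Suc n * B (replicate (Suc n) e)"
  have C: "0 \<le> C" using dominated_form_positive[OF dom] e by (simp add: C_def positive_form_def del: power_Suc replicate_Suc)
  \<comment> \<open>The + 1 keeps t positive when C = 0.\<close>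
  define t where "t = min 1 (\<epsilon> / (2 * (C + 1)))"
  have t: "0 < t" "t \<le> 1" using eps C by (simp_all add: t_def)
  have tC: "t * C \<le> \<epsilon> / 2"
  proof -
    have "t \<le> \<epsilon> / (2 * (C + 1))" by (simp add: t_def)
    then have "t * (2 * (C + 1)) \<le> \<epsilon>" using pos_le_divide_eq[of "2 * (C + 1)" t \<epsilon>] C by simp
    then show ?thesis using t by (simp add: algebra_simps)
  qed
  have Dpos: "0 \<le> d" if "d \<in> D" for d using D that by (simp add: null_directed_def)
  have "order_converges D (\<lambda>a b. b \<le> a) (\<lambda>d. x + t *\<^sub>R inf w d) x"
    unfolding order_converges_def
  proof (intro exI conjI)
    show "decreases_to_0 D (\<lambda>a b. b \<le> a) (\<lambda>a. t *\<^sub>R a)" by (rule null_directed_net(2)[OF D t(1)])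
    obtain d0 where d0: "d0 \<in> D" using D by (auto simp: null_directed_def)
    have "\<bar>x + t *\<^sub>R inf w d - x\<bar> \<le> t *\<^sub>R d" if "d \<in> D" for d
    proof -
      have "0 \<le> t *\<^sub>R inf w d" "t *\<^sub>R inf w d \<le> t *\<^sub>R d"
        using t w Dpos[OF that] by (simp_all add: scaleR_nonneg_nonneg scaleR_left_mono)
      then show ?thesis by simp
    qed
    with d0 show "\<exists>a0\<in>D. \<forall>a\<in>D. a \<le> a0 \<longrightarrow> \<bar>x + t *\<^sub>R inf w a - x\<bar> \<le> t *\<^sub>R a" by blast
  qed
  \<comment> \<open>This net is indexed by a subset of E; \<open>order_continuous_at_net\<close>
    admits every index type.\<close>
  then have "((\<lambda>d. ?P (x + t *\<^sub>R inf w d)) \<longlongrightarrow> ?P x) (tail_filter D (\<lambda>a b. b \<le> a))"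
    using oc null_directed_net(1)[OF D] by (intro order_continuous_at_net) (simp_all add: order_continuous_def)
  then have "eventually (\<lambda>d. dist (?P (x + t *\<^sub>R inf w d)) (?P x) < t * \<epsilon> / 2) (tail_filter D (\<lambda>a b. b \<le> a))"
    using t eps by (intro tendstoD) simp_all
  then obtain d1 where d1: "d1 \<in> D"
      "\<And>d. d \<in> D \<Longrightarrow> d \<le> d1 \<Longrightarrow> \<bar>?P (x + t *\<^sub>R inf w d) - ?P x\<bar> < t * \<epsilon> / 2"
    unfolding eventually_tail_filter[OF null_directed_net(1)[OF D]] by (auto simp: dist_real_def)
  have "\<bar>A (inf w d # replicate n x)\<bar> < \<epsilon>" if d: "d \<in> D" "d \<le> d1" for d
  proof -
    let ?a = "\<bar>A (inf w d # replicate n x)\<bar>"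
    have "real (Suc n) * t * ?a \<le> \<bar>?P (x + t *\<^sub>R inf w d) - ?P x\<bar> + t\<^sup>2 * C"
      unfolding C_def using x w e t Dpos[OF d(1)]
      by (intro taylor_first_order) (auto intro: order_trans[OF inf_le1])
    also have "\<dots> < t * \<epsilon> / 2 + t * (\<epsilon> / 2)"
    proof -
      have "t * (t * C) \<le> t * (\<epsilon> / 2)" using tC t by (intro mult_left_mono) simp_all
      then show ?thesis using d1(2)[OF d] unfolding power2_eq_square mult.assoc by linarith
    qed
    finally have "t * (real (Suc n) * ?a) < t * \<epsilon>" by (simp add: algebra_simps)
    then have "real (Suc n) * ?a < \<epsilon>" using t(1) by (simp only: mult_less_cancel_left_pos)
    moreover have "1 * ?a \<le> real (Suc n) * ?a" by (intro mult_right_mono) simp_all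
    ultimately show ?thesis by simp
  qed
  with d1(1) show ?thesis by blast
qed

text \<open>Let z nearly attain |h|(d0). Cutting z at a small d gives a part on which h is small by
  order continuity, and a part on which h is at most |h|(d0 - d) = |h|(d0) - |h|(d); hence |h|(d) is
  small. The three thirds of \<epsilon> pay for the choice of z and for its positive and negative
  parts.\<close>

lemma order_continuous_modulus_slot:
  assumes oc: "order_continuous (diagonal (Suc n) A)" and D: "null_directed D"
    and x: "0 \<le> x" and eps: "0 < \<epsilon>"
  shows "\<exists>d\<in>D. modulus_form A (d # replicate n x) < \<epsilon>"
proof -
  let ?X = "replicate n x"
  let ?h = "\<lambda>z. A (z # ?X)"
  have X: "?X \<in> cone_lists n" using x by simp
  note dh = slot[OF X]
  have lin: "linear ?h" using dh by (simp add: dominated_def)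
  have Dpos: "0 \<le> d" if "d \<in> D" for d using D that by (simp add: null_directed_def)
  obtain d0 where d0: "d0 \<in> D" using D by (auto simp: null_directed_def)
  obtain z where z: "\<bar>z\<bar> \<le> d0" "functional_modulus ?h d0 - \<epsilon> / 3 < ?h z"
    using functional_modulus_approx[OF Dpos[OF d0], of "\<epsilon>/3" ?h] eps by auto
  have "0 < \<epsilon> / 3" using eps by simp
  note slot_small = order_continuous_slot[OF oc D x zero_le_pprt this]
  obtain d1 where d1: "d1 \<in> D" "\<And>d. d \<in> D \<Longrightarrow> d \<le> d1 \<Longrightarrow> \<bar>?h (inf (pprt z) d)\<bar> < \<epsilon> / 3"
    using slot_small[of z] by blast
  obtain d2 where d2: "d2 \<in> D" "\<And>d. d \<in> D \<Longrightarrow> d \<le> d2 \<Longrightarrow> \<bar>?h (inf (pprt (- z)) d)\<bar> < \<epsilon> / 3"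
    using slot_small[of "- z"] by blast
  obtain d3 where d3: "d3 \<in> D" "d3 \<le> d1" "d3 \<le> d2"
    using D d1(1) d2(1) unfolding null_directed_def by blast
  obtain d where d: "d \<in> D" "d \<le> d3" "d \<le> d0"
    using D d3(1) d0 unfolding null_directed_def by blast
  have d12: "d \<le> d1" "d \<le> d2" using d d3 by (blast intro: order_trans)+
  let ?u = "inf (pprt z) d - inf (pprt (- z)) d" and ?v = "pprt (pprt z - d) - pprt (pprt (- z) - d)"
  have "?h z = ?h ?u + ?h ?v"
    using clip_abs(3)[OF Dpos[OF d(1)], of z] linear_add[OF lin] by metis
  moreover have "?h ?u = ?h (inf (pprt z) d) - ?h (inf (pprt (- z)) d)" by (rule linear_diff[OF lin])
  moreover have "?h ?v \<le> functional_modulus ?h (d0 - d)"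
  proof (rule functional_modulus_upper[OF dh])
    have "\<bar>z\<bar> - d \<le> d0 - d" using z(1) by (rule diff_right_mono)
    then have "pprt (\<bar>z\<bar> - d) \<le> d0 - d" using d(3) by (simp add: pprt_def)
    then show "\<bar>?v\<bar> \<le> d0 - d" by (rule order_trans[OF clip_abs(2)[OF Dpos[OF d(1)]]])
  qed
  moreover have "functional_modulus ?h d0 = functional_modulus ?h d + functional_modulus ?h (d0 - d)"
    using functional_modulus_add[OF dh Dpos[OF d(1)], of "d0 - d"] d(3) by simp
  ultimately have "functional_modulus ?h d < \<epsilon>"
    using z(2) d1(2)[OF d(1) d12(1)] d2(2)[OF d(1) d12(2)] by linarith
  then have "modulus_form A (d # ?X) < \<epsilon>" using modulus_form_Cons[OF Dpos[OF d(1)] X] by simp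
  with d(1) show ?thesis by blast
qed

section \<open>Bands and singular functionals\<close>

text \<open>The elements below \<open>x\<close> in the null ideal of \<open>K(\<cdot>, x, \<dots>, x)\<close> increase to \<open>x\<close>, because anything
  missing would be disjoint from that ideal.\<close>

lemma order_continuous_band:
  assumes oc: "order_continuous (diagonal (Suc n) A)"
    and K: "positive_form (Suc n) K" and le: "\<And>xs. xs \<in> cone_lists (Suc n) \<Longrightarrow> K xs \<le> modulus_form A xs"
    and x: "0 \<le> x"
    and full: "\<And>w. 0 \<le> w \<Longrightarrow> w \<le> x \<Longrightarrow> (\<And>y. K (\<bar>y\<bar> # replicate n x) = 0 \<Longrightarrow> inf w \<bar>y\<bar> = 0) \<Longrightarrow> w = 0"
  shows "K (replicate (Suc n) x) = 0"
proof -
  let ?X = "replicate n x"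
  have X: "?X \<in> cone_lists n" using x by simp
  note lin = positive_form_slot(1)[OF K X] and pos = positive_form_slot(2)[OF K X]
  note mono = positive_form_mono_slot[OF K _ X]
  define J where "J = {y. 0 \<le> y \<and> y \<le> x \<and> K (y # ?X) = 0}"
  have J0: "0 \<in> J" using x linear_0[OF lin] by (simp add: J_def)
  have nd: "null_directed ((\<lambda>y. x - y) ` J)"
    unfolding null_directed_def
  proof (intro conjI)
    show "(\<lambda>y. x - y) ` J \<noteq> {}" using J0 by blast
    show "\<forall>a\<in>(\<lambda>y. x - y) ` J. 0 \<le> a" by (auto simp: J_def)
    have "sup y y' \<in> J" if "y \<in> J" "y' \<in> J" for y y'
    proof -
      have yy: "0 \<le> y" "0 \<le> y'" "y \<le> x" "y' \<le> x" "K (y # ?X) = 0" "K (y' # ?X) = 0"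
        using that by (auto simp: J_def)
      have "sup y y' \<le> y + y'" using yy by (simp add: add_increasing add_increasing2)
      then have "K (sup y y' # ?X) \<le> K ((y + y') # ?X)" by (rule mono)
      also have "\<dots> = 0" using linear_add[OF lin] yy by simp
      finally have "K (sup y y' # ?X) = 0" using pos[of "sup y y'"] yy by (simp add: le_supI1)
      then show ?thesis using yy by (simp add: J_def le_supI1)
    qed
    then show "\<forall>a\<in>(\<lambda>y. x - y) ` J. \<forall>b\<in>(\<lambda>y. x - y) ` J. \<exists>c\<in>(\<lambda>y. x - y) ` J. c \<le> a \<and> c \<le> b"
      by (intro ballI; elim imageE) (meson diff_left_mono image_eqI sup_ge1 sup_ge2)
    show "\<forall>z\<ge>0. (\<forall>a\<in>(\<lambda>y. x - y) ` J. z \<le> a) \<longrightarrow> z = 0"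
    proof (intro allI impI)
      fix z assume z: "0 \<le> z" "\<forall>a\<in>(\<lambda>y. x - y) ` J. z \<le> a"
      have zJ: "z + y \<le> x" if "y \<in> J" for y using z(2) that by (simp add: le_diff_eq)
      show "z = 0"
      proof (rule full[OF z(1)])
        show "z \<le> x" using zJ[OF J0] by simp
        fix v assume v: "K (\<bar>v\<bar> # ?X) = 0"
        let ?q = "inf z \<bar>v\<bar>"
        have q: "0 \<le> ?q" using z(1) by simp
        have "K (?q # ?X) = 0" using mono[of ?q "\<bar>v\<bar>"] pos[OF q] v by simp
        then have Kq: "K ((c *\<^sub>R ?q) # ?X) = 0" for c using linear_scale[OF lin, of c ?q] by simp
        \<comment> \<open>If k q \<le> x, then k q belongs to J, so z + k q \<le> x, and q \<le> z
          gives (k + 1) q \<le> x. Thus all multiples of q stay below x.\<close>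
        have "real k *\<^sub>R ?q \<le> x" for k
        proof (induction k)
          case (Suc k)
          have "real k *\<^sub>R ?q \<in> J" using Suc Kq q by (simp add: J_def scaleR_nonneg_nonneg)
          from zJ[OF this] have "?q + real k *\<^sub>R ?q \<le> x"
            by (rule order_trans[rotated]) (simp add: add_right_mono)
          then show ?case by (simp add: scaleR_left_distrib)
        qed (use x in simp)
        then show "?q = 0" by (rule archimedean_zero[OF q])
      qed
    qed
  qed
  have "\<bar>K (x # ?X)\<bar> \<le> \<epsilon> * 1" if "0 < \<epsilon>" for \<epsilon>
  proof -
    obtain y where y: "y \<in> J" "modulus_form A ((x - y) # ?X) < \<epsilon>"
      using order_continuous_modulus_slot[OF oc nd x \<open>0 < \<epsilon>\<close>] by auto
    have "K (x # ?X) = K (y # ?X) + K ((x - y) # ?X)" using linear_diff[OF lin, of x y] by simp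
    also have "K (y # ?X) = 0" using y(1) by (simp add: J_def)
    also have "K ((x - y) # ?X) \<le> modulus_form A ((x - y) # ?X)"
      using y(1) X by (intro le) (simp add: J_def)
    finally show ?thesis using y(2) pos[OF x] by simp
  qed
  then show ?thesis using zero_of_eps_bound[of "K (x # ?X)" 1] by simp
qed

text \<open>\<open>sing\<close> is the formula for the infimum of two positive functionals having
  value 0 at x, and \<open>null\<close> makes g strictly positive on [0, x]. The latter forces a
  decreasing sequence along which g tends to 0 to have infimum 0.\<close>

lemma order_continuous_singular:
  assumes oc: "order_continuous (diagonal (Suc n) A)" and x: "0 \<le> x"
    and lin: "linear g" and pos: "\<And>z. 0 \<le> z \<Longrightarrow> 0 \<le> g z"
    and sing: "\<And>\<epsilon>. 0 < \<epsilon> \<Longrightarrow> \<exists>y. 0 \<le> y \<and> y \<le> x \<and> modulus_form A ((x - y) # replicate n x) + g y < \<epsilon>"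
    and null: "\<And>z. 0 \<le> z \<Longrightarrow> z \<le> x \<Longrightarrow> g z = 0 \<Longrightarrow> z = 0"
  shows "modulus_form A (replicate (Suc n) x) = 0"
proof -
  let ?X = "replicate n x"
  let ?f = "\<lambda>y. modulus_form A (y # ?X)"
  have X: "?X \<in> cone_lists n" using x by simp
  have pN: "positive_form (Suc n) (modulus_form A)" by (rule dominated_form_positive[OF dominated_form_modulus])
  note flin = positive_form_slot(1)[OF pN X] and fpos = positive_form_slot(2)[OF pN X]
  have "\<bar>?f x\<bar> \<le> \<epsilon> * 2" if eps: "0 < \<epsilon>" for \<epsilon>
  proof -
    \<comment> \<open>The errors are geometric because passing to the infimum of y_0, ..., y_i adds
      up the f(x - y_j): their sum stays below \<epsilon> (1 - 2^-(i+1)). For g the last term alone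
      counts, since u_i \<le> y_i.\<close>
    have "\<exists>y. 0 \<le> y \<and> y \<le> x \<and> ?f (x - y) + g y < \<epsilon> * (1/2) ^ Suc i" for i :: nat
      using eps by (intro sing) simp
    then obtain y where y: "\<And>i. 0 \<le> y i" "\<And>i. y i \<le> x" "\<And>i. ?f (x - y i) + g (y i) < \<epsilon> * (1/2) ^ Suc i"
      by metis
    define u where "u = rec_nat (y 0) (\<lambda>i v. inf v (y (Suc i)))"
    have u: "u 0 = y 0" "u (Suc i) = inf (u i) (y (Suc i))" for i by (simp_all add: u_def)
    have u0: "0 \<le> u i" for i by (induction i) (simp_all add: u y)
    have uy: "u i \<le> y i" for i by (cases i) (simp_all add: u)
    have ux: "u i \<le> x" for i using uy y(2) by (blast intro: order_trans)
    have anti: "decseq u" by (rule decseq_SucI) (simp add: u)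
    have fy: "?f (x - y i) < \<epsilon> * (1/2) ^ Suc i" "g (y i) < \<epsilon> * (1/2) ^ Suc i" for i
      using y(3)[of i] fpos[of "x - y i"] pos[of "y i"] y(1,2)[of i] by simp_all
    have fu: "?f (x - u i) \<le> \<epsilon> * (1 - (1/2) ^ Suc i)" for i
    proof (induction i)
      case 0
      then show ?case using fy(1)[of 0] by (simp add: u)
    next
      case (Suc i)
      have "x - u (Suc i) = sup (x - u i) (x - y (Suc i))"
        by (simp add: u diff_inf_eq_sup add_sup_distrib_left)
      also have "\<dots> \<le> (x - u i) + (x - y (Suc i))"
        using ux[of i] y(2)[of "Suc i"] by (simp add: add_increasing add_increasing2)
      finally have "?f (x - u (Suc i)) \<le> ?f ((x - u i) + (x - y (Suc i)))"
        by (rule positive_form_mono_slot[OF pN _ X])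
      also have "\<dots> = ?f (x - u i) + ?f (x - y (Suc i))" by (rule linear_add[OF flin])
      finally show ?case using Suc fy(1)[of "Suc i"] by (simp add: algebra_simps)
    qed
    have "null_directed (range u)"
      unfolding null_directed_def
    proof (intro conjI)
      show "\<forall>a\<in>range u. \<forall>b\<in>range u. \<exists>c\<in>range u. c \<le> a \<and> c \<le> b"
        using decseqD[OF anti] by (metis imageE max.cobounded1 max.cobounded2 rangeI)
      show "\<forall>z\<ge>0. (\<forall>a\<in>range u. z \<le> a) \<longrightarrow> z = 0"
      proof (intro allI impI)
        fix z assume z: "0 \<le> z" "\<forall>a\<in>range u. z \<le> a"
        then have zy: "z \<le> y i" for i using uy[of i] by (blast intro: order_trans)
        have gz: "g z \<le> \<epsilon> * (1/2) ^ Suc i" for i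
          using linear_mono_cone[OF lin pos zy[of i]] fy(2)[of i] by simp
        have "(\<lambda>i. \<epsilon> * (1/2) ^ Suc i) \<longlonglongrightarrow> \<epsilon> * 0"
          by (intro tendsto_mult_left LIMSEQ_Suc LIMSEQ_power_zero) simp
        then have "g z \<le> \<epsilon> * 0" by (rule LIMSEQ_le_const) (use gz in blast)
        then have "g z = 0" using pos[OF z(1)] by simp
        moreover have "z \<le> x" using zy[of 0] y(2)[of 0] by (rule order_trans)
        ultimately show "z = 0" using null z(1) by blast
      qed
    qed (use u0 in auto)
    from order_continuous_modulus_slot[OF oc this x eps] obtain i where i: "?f (u i) < \<epsilon>" by blast
    have "?f x = ?f (u i) + ?f (x - u i)" using linear_diff[OF flin, of x "u i"] by simp
    moreover have "\<epsilon> * (1 - (1/2) ^ Suc i) \<le> \<epsilon> * 1" using eps by (intro mult_left_mono) simp_all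
    ultimately show ?thesis using i fu[of i] fpos[OF x] by simp
  qed
  then show ?thesis using zero_of_eps_bound[of "?f x" 2] by simp
qed

end

section \<open>Disjoint polynomials and disjoint carriers\<close>

lemma orthogonally_additive_form:
  assumes "orthogonally_additive_poly (Suc n) P"
  obtains A B where "orthosymmetric_form n A B" "P = diagonal (Suc n) A"
proof -
  obtain A B where AB: "dominated_form (Suc n) A B" "P = diagonal (Suc n) A"
    using assms unfolding orthogonally_additive_poly_def by (blast elim: regular_polyE)
  have "orthosymmetric (Suc n) A"
    using assms unfolding AB(2) orthogonally_additive_poly_def diagonal_def
    by (intro orthogonally_additive_orthosymmetric[OF AB(1)]) blast
  then show thesis using AB by (intro that) (auto simp: orthosymmetric_form_def)
qed

theorem theorem7:
  fixes P Q :: "'a::banach_lattice \<Rightarrow> real" and m :: nat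
  assumes "m > 0"
    and "orthogonally_additive_poly m P"
    and "orthogonally_additive_poly m Q"
    and "order_continuous P"
  shows "poly_disjoint m P Q \<longleftrightarrow> disjoint_subsets (poly_carrier m P) (poly_carrier m Q)"
proof -
  obtain n where m: "m = Suc n" using assms(1) by (cases m) auto
  obtain A1 B1 where P: "orthosymmetric_form n A1 B1" "P = diagonal m A1"
    using assms(2) unfolding m by (rule orthogonally_additive_form)
  obtain A2 B2 where Q: "orthosymmetric_form n A2 B2" "Q = diagonal m A2"
    using assms(3) unfolding m by (rule orthogonally_additive_form)
  interpret P: orthosymmetric_form n A1 B1 by (rule P)
  interpret Q: orthosymmetric_form n A2 B2 by (rule Q)
  let ?M = "modulus_form A1" and ?N = "modulus_form A2"
  have absP: "poly_abs m P = diagonal m ?M" and absQ: "poly_abs m Q = diagonal m ?N"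
    unfolding m P(2) Q(2) by (rule P.poly_abs_diagonal, rule Q.poly_abs_diagonal)
  have pM: "positive_form (Suc n) ?M" and pN: "positive_form (Suc n) ?N"
    using dominated_form_positive P.dominated_form_modulus Q.dominated_form_modulus by blast+
  note oM = P.orthosymmetric_modulus_form and oN = Q.orthosymmetric_modulus_form
  note K = positive_form_inf[OF pM oM pN oN] and K_le = inf_form_le[OF pM oM pN oN]
  have oc: "order_continuous (diagonal (Suc n) A1)" using assms(4) by (simp add: P(2) m)
  have disjoint_iff: "poly_disjoint m P Q \<longleftrightarrow> (\<forall>x. inf_form ?M ?N (replicate (Suc n) x) = 0)"
    unfolding poly_disjoint_def absP absQ
    unfolding m poly_inf_diagonal[OF pM oM pN oN] diagonal_def fun_eq_iff ..
  have null_P: "x \<in> null_ideal m P \<longleftrightarrow> ?M (replicate (Suc n) \<bar>x\<bar>) = 0"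
    and null_Q: "x \<in> null_ideal m Q \<longleftrightarrow> ?N (replicate (Suc n) \<bar>x\<bar>) = 0" for x
    unfolding null_ideal_def absP absQ unfolding m diagonal_def mem_Collect_eq by (rule refl)+
  show ?thesis
  proof
    assume dis: "poly_disjoint m P Q"
    have "x \<in> null_ideal m P" if x: "x \<in> poly_carrier m Q" for x
    proof -
      let ?X = "replicate n \<bar>x\<bar>"
      have X: "?X \<in> cone_lists n" by simp
      interpret D: orthosymmetric_form n "\<lambda>xs. ?M xs - ?N xs" "\<lambda>xs. ?M xs + ?N xs"
        by (rule orthosymmetric_form_diff[OF pM oM pN oN])
      let ?h = "\<lambda>z. ?M (z # ?X) - ?N (z # ?X)"
      note linM = positive_form_slot(1)[OF pM X] and linN = positive_form_slot(1)[OF pN X]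
      \<comment> \<open>A vanishing infimum means that |M - N| = M + N at this list, so some z in
        [-|x|, |x|] nearly attains the right-hand side.\<close>
      have "functional_modulus ?h \<bar>x\<bar> = ?M (\<bar>x\<bar> # ?X) + ?N (\<bar>x\<bar> # ?X)"
        using dis D.modulus_form_Cons[OF abs_ge_zero X, of x] by (simp add: disjoint_iff inf_form_def)
      then have h: "\<exists>z. \<bar>z\<bar> \<le> \<bar>x\<bar> \<and> ?M (\<bar>x\<bar> # ?X) + ?N (\<bar>x\<bar> # ?X) - \<epsilon> < ?h z" if "0 < \<epsilon>" for \<epsilon>
        using functional_modulus_approx[OF abs_ge_zero that, of x ?h] by simp
      have "?M (replicate (Suc n) \<bar>x\<bar>) = 0"
      proof (rule P.order_continuous_singular[OF oc abs_ge_zero linN])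
        show "0 \<le> ?N (z # ?X)" if "0 \<le> z" for z using that by (intro positive_form_slot(2)[OF pN X])
        show "\<exists>y. 0 \<le> y \<and> y \<le> \<bar>x\<bar> \<and> ?M ((\<bar>x\<bar> - y) # ?X) + ?N (y # ?X) < \<epsilon>" if "0 < \<epsilon>" for \<epsilon>
        proof -
          obtain z where z: "\<bar>z\<bar> \<le> \<bar>x\<bar>" "?M (\<bar>x\<bar> # ?X) + ?N (\<bar>x\<bar> # ?X) - \<epsilon> < ?h z"
            using h[OF \<open>0 < \<epsilon>\<close>] by blast
          \<comment> \<open>The affine map of [-|x|, |x|] onto [0, |x|]. With f and g the
            functionals of \<open>?M\<close> and \<open>?N\<close>, it turns f(|x|) + g(|x|) - h(z)
            into twice f(|x| - y) + g(y).\<close>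
          define y where "y = (1/2) *\<^sub>R (\<bar>x\<bar> + z)"
          have y': "\<bar>x\<bar> - y = (1/2) *\<^sub>R (\<bar>x\<bar> - z)"
            unfolding y_def using scaleR_half_double[of "\<bar>x\<bar>"] by (simp add: algebra_simps flip: scaleR_add_left)
          have "z \<le> \<bar>x\<bar>" "- z \<le> \<bar>x\<bar>" using z(1) by (simp_all add: abs_le_iff)
          then have "0 \<le> \<bar>x\<bar> - z" "0 \<le> \<bar>x\<bar> + z"
            using add_right_mono[of "- z" "\<bar>x\<bar>" z] by simp_all
          then have "0 \<le> y" "0 \<le> \<bar>x\<bar> - y" unfolding y' unfolding y_def by (simp_all add: scaleR_nonneg_nonneg)
          moreover have "?M ((\<bar>x\<bar> - y) # ?X) = (?M (\<bar>x\<bar> # ?X) - ?M (z # ?X)) / 2"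
            unfolding y' using linear_scale[OF linM] linear_diff[OF linM] by simp
          moreover have "?N (y # ?X) = (?N (\<bar>x\<bar> # ?X) + ?N (z # ?X)) / 2"
            unfolding y_def using linear_scale[OF linN] linear_add[OF linN] by simp
          ultimately show ?thesis using z(2) \<open>0 < \<epsilon>\<close> by (intro exI[of _ y]) simp
        qed
        \<comment> \<open>Strict positivity on [0, |x|]: by monotonicity N(z, ..., z) \<le> N(z,
          |x|, ..., |x|) = 0, so z is in N(Q), while z \<le> |x| with x in C(Q).\<close>
        fix z assume z: "0 \<le> z" "z \<le> \<bar>x\<bar>" "?N (z # ?X) = 0"
        have "?N (replicate (Suc n) z) \<le> ?N (z # ?X)"
        proof -
          have "list_all2 (\<le>) (replicate n z) ?X" using z by (simp add: list_all2_conv_all_nth)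
          then show ?thesis
            using positive_form_mono[OF pN, of "replicate (Suc n) z" "z # ?X" "[]"] z by simp
        qed
        moreover have "0 \<le> ?N (replicate (Suc n) z)"
          using positive_form_slot(2)[OF pN, of "replicate n z" z] z by simp
        ultimately have "z \<in> null_ideal m Q" using z by (simp add: null_Q)
        then have "inf \<bar>x\<bar> \<bar>z\<bar> = 0" using x by (auto simp: poly_carrier_def mem_disjoint_complement)
        moreover have "inf \<bar>x\<bar> \<bar>z\<bar> = z" using z by (simp add: inf_absorb2)
        ultimately show "z = 0" by simp
      qed
      then show ?thesis by (simp add: null_P)
    qed
    then show "disjoint_subsets (poly_carrier m P) (poly_carrier m Q)"
      unfolding disjoint_subsets_def by (auto simp: poly_carrier_def[of m P] disjoint_complement_def)
  next
    assume dis: "disjoint_subsets (poly_carrier m P) (poly_carrier m Q)"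
    have zero: "inf_form ?M ?N (replicate (Suc n) x) = 0" if x: "0 \<le> x" for x
    proof (rule P.order_continuous_band[OF oc K K_le(1) x])
      let ?X = "replicate n x"
      have X: "?X \<in> cone_lists n" using x by simp
      fix w assume w: "0 \<le> w" "\<And>y. inf_form ?M ?N (\<bar>y\<bar> # ?X) = 0 \<Longrightarrow> inf w \<bar>y\<bar> = 0"
      \<comment> \<open>To place w in both carriers, \<open>positive_form_null_slot\<close> is
        combined with this: membership in N(P) or N(Q) concerns y in all slots, whereas w is only
        known to be disjoint from null elements of the functional with x frozen. Being in both
        carriers, w is disjoint from itself.\<close>
      have K0: "inf_form ?M ?N (\<bar>y\<bar> # ?X) = 0" if "?M (\<bar>y\<bar> # ?X) = 0 \<or> ?N (\<bar>y\<bar> # ?X) = 0" for y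
        using that K_le[of "\<bar>y\<bar> # ?X"] X positive_form_slot(2)[OF K X abs_ge_zero, of y] by auto
      have "w \<in> poly_carrier m P"
        using w K0 positive_form_null_slot[OF pM oM x abs_ge_zero]
        by (auto simp: poly_carrier_def mem_disjoint_complement null_P simp del: replicate_Suc)
      moreover have "w \<in> poly_carrier m Q"
        using w K0 positive_form_null_slot[OF pN oN x abs_ge_zero]
        by (auto simp: poly_carrier_def mem_disjoint_complement null_Q simp del: replicate_Suc)
      ultimately have "inf \<bar>w\<bar> \<bar>w\<bar> = 0"
        using dis unfolding disjoint_subsets_def disjoint_elts_def by blast
      then show "w = 0" by simp
    qed
    \<comment> \<open>By monotonicity a positive form at a list from the cone is at most its
      diagonal value at the sum of the entries. From the cone the zero form spreads to all lists, in
      particular to diagonal values at elements without sign.\<close>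
    have cone: "inf_form ?M ?N xs = 0" if xs: "xs \<in> cone_lists (Suc n)" for xs
    proof -
      have x: "0 \<le> x" "x \<le> sum_list xs" if "x \<in> set xs" for x
        using xs that by (auto simp: cone_lists_def intro: sum_list_upper)
      then have "inf_form ?M ?N xs \<le> inf_form ?M ?N (replicate (Suc n) (sum_list xs))"
        by (intro positive_form_le_power[OF K xs])
      also have "\<dots> = 0" using x(1) by (intro zero sum_list_nonneg)
      finally show ?thesis using K xs by (force simp: positive_form_def intro: antisym)
    qed
    have s: "symmetric_multilinear (Suc n) (inf_form ?M ?N)" using K by (simp add: positive_form_def)
    have "symmetric_multilinear (Suc n) (\<lambda>_::'a list. 0)"
      using symmetric_multilinear_comb[OF s s, of 0 0] by simp
    then have "inf_form ?M ?N (replicate (Suc n) x) = 0" for x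
      using cone by (rule form_eq_of_cone[OF s]) simp_all
    then show "poly_disjoint m P Q" unfolding disjoint_iff by blast
  qed
qed

end
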